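(* Let $A, B\subset \mathbb{R}^d$ be bounded measurable sets, and let $f, g \in L^1(\mathbb{R}^d)\cap L^2(\mathbb{R}^d)$ be bounded functions with $f$ supported on $A$ and $g$ supported on $B$. Then: (a) $f*g$ is continuous on $\mathbb{R}^d$ and is Poisson summation friendly. (b) Consequently, for every full-rank lattice $\mathcal{L}\subset\mathbb{R}^d$ and every $x\in\mathbb{R}^d$, \[ \sum_{n\in\mathcal{L}} (f*g)(x+n) =\frac{1}{\det \mathcal{L}} \sum_{\xi \in \mathcal{L}^*} \hat{f}(\xi)\hat{g}(\xi) e^{2\pi i \langle \xi, x \rangle}. \] (c) In particular (taking $f=1_A$, $g=1_{-B}$), for every full-rank lattice $\mathcal{L}\subset\mathbb{R}^d$ and every $x\in\mathbb{R}^d$, \[ \sum_{n\in\mathcal{L}} \operatorname{vol}\big(A\cap(B+x+n)\big)=\frac{1}{\det \mathcal{L}} \sum_{\xi \in \mathcal{L}^*} \hat{1}_{A}(\xi)\,\overline{\hat{1}_{B}(\xi)}\, e^{2\pi i \langle \xi, x \rangle}. \]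
   Context: The Fourier transform is $\hat h(\xi)=\int_{\mathbb{R}^d} h(x)e^{-2\pi i\langle x,\xi\rangle}\,dx$; $1_S$ denotes the indicator function of $S$ and $-B=\{-b: b\in B\}$. $(f*g)(x)=\int_{\mathbb{R}^d} f(t)g(x-t)\,dt$. For a full-rank lattice $\mathcal{L}\subset\mathbb{R}^d$, $\det\mathcal{L}$ is the volume of a fundamental parallelepiped and $\mathcal{L}^*=\{\xi\in\mathbb{R}^d:\langle \xi,n\rangle\in\mathbb{Z}\ \forall n\in\mathcal{L}\}$ is the dual lattice. A function $h:\mathbb{R}^d\to\mathbb{C}$ is called Poisson summation friendly if for every full-rank lattice $\mathcal{L}$ and every $x\in\mathbb{R}^d$ one has $\sum_{n\in\mathcal{L}} h(n+x)=\frac{1}{\det\mathcal{L}}\sum_{m\in\mathcal{L}^*}\hat h(m)e^{2\pi i\langle m,x\rangle}$ (equality pointwise). $\operatorname{vol}$ is Lebesgue measure. *)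

theory Defs
  imports "HOL-Analysis.Analysis"
begin

text \<open>Integrals are taken over \<^const>\<open>lebesgue\<close> rather than \<^const>\<open>lborel\<close>, so that Lebesgue
  measurable sets and functions are covered. For complex-valued families, \<^const>\<open>summable_on\<close>
  is absolute convergence.\<close>

definition fourier :: "(real^'d \<Rightarrow> complex) \<Rightarrow> real^'d \<Rightarrow> complex" where
  "fourier h \<xi> =
     (LINT x|lebesgue. h x * exp (- 2 * complex_of_real pi * \<i> * complex_of_real (x \<bullet> \<xi>)))"

definition convolution ::
    "(real^'d \<Rightarrow> complex) \<Rightarrow> (real^'d \<Rightarrow> complex) \<Rightarrow> real^'d \<Rightarrow> complex" where
  "convolution f g x = (LINT t|lebesgue. f t * g (x - t))"

definition in_L1_L2 :: "(real^'d \<Rightarrow> complex) \<Rightarrow> bool" where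
  "in_L1_L2 f \<longleftrightarrow> integrable lebesgue f \<and> integrable lebesgue (\<lambda>x. (norm (f x))\<^sup>2)"

text \<open>The columns of the matrix are the vectors of a basis of the lattice.\<close>

definition lattice_basis :: "real^'d^'d \<Rightarrow> (real^'d) set \<Rightarrow> bool" where
  "lattice_basis M L \<longleftrightarrow> invertible M \<and> L = {M *v k |k. \<forall>i. k $ i \<in> \<int>}"

definition full_rank_lattice :: "(real^'d) set \<Rightarrow> bool" where
  "full_rank_lattice L \<longleftrightarrow> (\<exists>M. lattice_basis M L)"

definition fundamental_parallelepiped :: "real^'d^'d \<Rightarrow> (real^'d) set" where
  "fundamental_parallelepiped M = {M *v t |t. \<forall>i. 0 \<le> t $ i \<and> t $ i < 1}"

text \<open>The choice of basis does not matter: see \<open>lattice_det_eq\<close> below.\<close>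

definition lattice_det :: "(real^'d) set \<Rightarrow> real" where
  "lattice_det L = measure lebesgue (fundamental_parallelepiped (SOME M. lattice_basis M L))"

definition dual_lattice :: "(real^'d) set \<Rightarrow> (real^'d) set" where
  "dual_lattice L = {\<xi>. \<forall>n\<in>L. \<xi> \<bullet> n \<in> \<int>}"

text \<open>The integrability and summability conditions say that the transform and the two series
  exist; without them \<^const>\<open>lebesgue_integral\<close> and \<^const>\<open>infsum\<close> would silently be \<open>0\<close>.\<close>

definition poisson_summation_friendly :: "(real^'d \<Rightarrow> complex) \<Rightarrow> bool" where
  "poisson_summation_friendly h \<longleftrightarrow>
     integrable lebesgue h \<and>
     (\<forall>L x. full_rank_lattice L \<longrightarrow>
        (\<lambda>n. h (n + x)) summable_on L \<and>
        (\<lambda>m. fourier h m * exp (2 * complex_of_real pi * \<i> * complex_of_real (m \<bullet> x)))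
          summable_on dual_lattice L \<and>
        (\<Sum>\<^sub>\<infinity>n\<in>L. h (n + x)) =
          1 / complex_of_real (lattice_det L) *
          (\<Sum>\<^sub>\<infinity>m\<in>dual_lattice L.
             fourier h m * exp (2 * complex_of_real pi * \<i> * complex_of_real (m \<bullet> x))))"

text \<open>The library's \<open>measure_linear_image\<close> needs a well-ordered index type; the following
  version does not.\<close>

lemma measure_linear_image_cart:
  fixes f :: "real^'d \<Rightarrow> real^'d"
  assumes "linear f" and "S \<in> lmeasurable"
  shows "f ` S \<in> lmeasurable \<and> measure lebesgue (f ` S) = \<bar>det (matrix f)\<bar> * measure lebesgue S"
proof -
  define P where "P f \<longleftrightarrow> (\<forall>S\<in>lmeasurable. f ` S \<in> lmeasurable \<and>
      measure lebesgue (f ` S) = \<bar>det (matrix f)\<bar> * measure lebesgue S)" for f :: "real^'d \<Rightarrow> real^'d"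
  have unimodular: "P h"
    if "linear h" "\<bar>det (matrix h)\<bar> = 1"
      and box: "\<And>a b. cbox a b \<noteq> {} \<Longrightarrow> measure lebesgue (h ` cbox a b) = measure lebesgue (cbox a b)"
    for h :: "real^'d \<Rightarrow> real^'d"
  proof -
    have "measure lebesgue (h ` cbox a b) = 1 * measure lebesgue (cbox a b)" for a b
      using box[of a b] by (cases "cbox a b = {}") auto
    from measure_linear_sufficient[OF that(1) _ this] show ?thesis
      unfolding P_def that(2) by metis
  qed
  have "P f"
  proof (rule induct_linear_elementary[OF assms(1)])
    fix f g :: "real^'d \<Rightarrow> real^'d"
    assume "linear f" "linear g" "P f" "P g"
    then show "P (f \<circ> g)"
      unfolding P_def image_comp[symmetric] by (auto simp: matrix_compose det_mul abs_mult)
  next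
    fix f :: "real^'d \<Rightarrow> real^'d" and i
    assume f: "linear f" and z: "\<And>x. f x $ i = 0"
    have "negligible (f ` S)" for S
      by (rule negligible_subset[OF negligible_standard_hyperplane_cart[of i]]) (auto simp: z)
    moreover have "row i (matrix f) = 0"
      by (simp add: row_def matrix_def z vec_eq_iff)
    ultimately show "P f"
      by (simp add: P_def det_zero_row(2) negligible_iff_measure)
  next
    fix c :: "'d \<Rightarrow> real"
    have "det (matrix (\<lambda>x. \<chi> i. c i * x $ i)) = prod c UNIV"
      by (subst det_diagonal) (auto simp: matrix_def axis_def)
    then show "P (\<lambda>x. \<chi> i. c i * x $ i)"
      by (simp add: P_def measurable_stretch measure_stretch)
  next
    fix m n :: 'd
    assume "m \<noteq> n"
    let ?t = "Transposition.transpose m n"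
    let ?h = "\<lambda>x::real^'d. \<chi> i. x $ ?t i"
    have "matrix ?h = (\<chi> i. (mat 1 :: real^'d^'d) $ ?t i)"
      by (auto simp: matrix_def axis_def mat_def vec_eq_iff)
    then have det: "\<bar>det (matrix ?h)\<bar> = 1"
      by (simp add: det_permute_rows permutes_swap_id sign_swap_id \<open>m \<noteq> n\<close>)
    have lin: "linear ?h"
      by (rule linearI) (simp_all add: vec_eq_iff)
    show "P ?h"
    proof (rule unimodular[OF lin det])
      fix a b :: "real^'d"
      assume ne: "cbox a b \<noteq> {}"
      have inv: "?h (?h x) = x" for x
        by (simp add: vec_eq_iff)
      have mem: "?h x \<in> cbox (?h u) (?h v)" if "x \<in> cbox u v" for x u v
        using that by (simp add: mem_box_cart)
      have eq: "?h ` cbox a b = cbox (?h a) (?h b)"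
      proof (intro equalityI subsetI)
        fix y assume "y \<in> cbox (?h a) (?h b)"
        then have "?h y \<in> cbox a b"
          using mem[of y "?h a" "?h b"] by (simp only: inv)
        then show "y \<in> ?h ` cbox a b"
          by (rule image_eqI[where f = ?h, rotated]) (simp only: inv)
      qed (use mem in blast)
      then have ne': "cbox (?h a) (?h b) \<noteq> {}"
        using ne by blast
      have "(\<Prod>i\<in>UNIV. b $ ?t i - a $ ?t i) = (\<Prod>i\<in>UNIV. b $ i - a $ i)"
        by (rule prod.reindex_bij_betw[of ?t UNIV UNIV "\<lambda>i. b $ i - a $ i"]) simp
      then show "measure lebesgue (?h ` cbox a b) = measure lebesgue (cbox a b)"
        unfolding eq using ne ne' by (simp add: content_cbox_cart)
    qed
  next
    fix m n :: 'd
    assume "m \<noteq> n"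
    let ?h = "\<lambda>x::real^'d. \<chi> i. if i = m then x $ m + x $ n else x $ i"
    let ?I = "mat 1 :: real^'d^'d"
    have "matrix ?h = (\<chi> k. if k = m then row m ?I + 1 *s row n ?I else row k ?I)"
      by (auto simp: matrix_def axis_def mat_def row_def vec_eq_iff)
    then have det: "\<bar>det (matrix ?h)\<bar> = 1"
      using det_row_operation[OF \<open>m \<noteq> n\<close>, of ?I 1] by simp
    have lin: "linear ?h"
      by (rule linearI) (auto simp: vec_eq_iff algebra_simps)
    show "P ?h"
    proof (rule unimodular[OF lin det])
      fix a b :: "real^'d"
      assume ne: "cbox a b \<noteq> {}"
      define v :: "real^'d" where "v = - axis n (a $ n)"
      have shifted: "cbox (v + a) (v + b) = (+) v ` cbox a b"
        by (rule cbox_translation)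
      have "?h ` (+) v ` cbox a b = (+) (?h v) ` ?h ` cbox a b"
        unfolding image_image by (intro image_cong refl linear_add[OF lin])
      then have "measure lebesgue (?h ` cbox a b) = measure lebesgue (?h ` cbox (v + a) (v + b))"
        by (simp only: shifted measure_translation)
      also have "\<dots> = measure lebesgue (cbox (v + a) (v + b))"
        by (intro measure_shear_interval \<open>m \<noteq> n\<close>)
          (use ne shifted in \<open>auto simp: v_def\<close>)
      also have "\<dots> = measure lebesgue (cbox a b)"
        by (simp only: shifted measure_translation)
      finally show "measure lebesgue (?h ` cbox a b) = measure lebesgue (cbox a b)" .
    qed
  qed
  then show ?thesis
    using assms(2) by (simp add: P_def)
qed

lemma measure_fundamental_parallelepiped:
  fixes M :: "real^'d^'d"
  shows "measure lebesgue (fundamental_parallelepiped M) = \<bar>det M\<bar>"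
proof -
  define H :: "(real^'d) set" where "H = {t. \<forall>i. 0 \<le> t $ i \<and> t $ i < 1}"
  have sub: "box 0 1 \<subseteq> H" "H \<subseteq> cbox 0 1"
    by (auto simp: H_def mem_box_cart less_imp_le)
  have one: "measure lebesgue (cbox 0 (1::real^'d)) = 1"
    by (simp add: content_cbox_cart interval_ne_empty_cart)
  have "negligible (cbox 0 1 - box 0 (1::real^'d))"
    by (rule negligible_frontier_interval)
  then have neg: "negligible (cbox 0 1 - H)"
    by (rule negligible_subset) (use sub in auto)
  have sd: "negligible (sym_diff (cbox 0 1) H)"
    using neg sub(2) by (simp add: Diff_eq_empty_iff[THEN iffD2])
  have lm: "H \<in> lmeasurable"
    by (rule lmeasurable_negligible_symdiff[OF lmeasurable_cbox sd])
  have m: "measure lebesgue H = 1"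
    using measure_negligible_symdiff[OF lmeasurable_cbox sd] one by simp
  have "fundamental_parallelepiped M = (*v) M ` H"
    by (auto simp: fundamental_parallelepiped_def H_def)
  then show ?thesis
    using measure_linear_image_cart[OF matrix_vector_mul_linear[of M] lm] m by simp
qed

lemma det_in_Ints:
  fixes K :: "real^'d^'d"
  assumes "\<And>i j. K $ i $ j \<in> \<int>"
  shows "det K \<in> \<int>"
  unfolding det_def using assms by (intro Ints_sum Ints_mult Ints_prod) auto

lemma lattice_basis_change:
  fixes M N :: "real^'d^'d"
  assumes "lattice_basis M L" "lattice_basis N L"
  shows "\<exists>k\<in>\<int>. det N = det M * k"
proof -
  have "\<exists>k. N *v axis j 1 = M *v k \<and> (\<forall>i. k $ i \<in> \<int>)" for j
  proof -
    have "N *v axis j 1 \<in> L"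
      using assms(2) by (auto simp: lattice_basis_def axis_def)
    then show ?thesis using assms(1) by (auto simp: lattice_basis_def)
  qed
  then obtain k where k: "\<And>j. N *v axis j 1 = M *v k j" "\<And>i j. k j $ i \<in> \<int>"
    by metis
  define K :: "real^'d^'d" where "K = (\<chi> i j. k j $ i)"
  have "column j K = k j" for j
    by (simp add: K_def column_def vec_eq_iff)
  then have "N *v axis j 1 = (M ** K) *v axis j 1" for j
    by (metis k(1) matrix_vector_mul_assoc matrix_vector_mult_basis)
  then have "N = M ** K"
    by (simp add: matrix_vector_mult_basis vec_eq_iff column_def)
  moreover have "det K \<in> \<int>"
    by (rule det_in_Ints) (simp add: K_def k(2))
  ultimately show ?thesis by (auto simp: det_mul)
qed

lemma lattice_basis_abs_det_unique:
  fixes M N :: "real^'d^'d"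
  assumes "lattice_basis M L" "lattice_basis N L"
  shows "\<bar>det M\<bar> = \<bar>det N\<bar>"
proof -
  have *: "\<bar>det M'\<bar> \<le> \<bar>det N'\<bar>"
    if h: "lattice_basis M' L" "lattice_basis N' L" for M' N' :: "real^'d^'d"
  proof -
    obtain k where k: "k \<in> \<int>" "det N' = det M' * k"
      using lattice_basis_change[OF h] by blast
    have "det N' \<noteq> 0"
      using h(2) by (simp add: lattice_basis_def invertible_det_nz)
    then have "1 \<le> \<bar>k\<bar>" using k by (intro Ints_nonzero_abs_ge1) auto
    then show ?thesis by (simp add: k(2) abs_mult mult_le_cancel_left1)
  qed
  show ?thesis using *[OF assms] *[OF assms(2,1)] by simp
qed

lemma lattice_det_eq:
  assumes "lattice_basis M L"
  shows "lattice_det L = measure lebesgue (fundamental_parallelepiped M)"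
    and "lattice_det L = \<bar>det M\<bar>"
proof -
  have "lattice_basis (SOME M. lattice_basis M L) L"
    using assms by (rule someI)
  then show "lattice_det L = \<bar>det M\<bar>"
    unfolding lattice_det_def measure_fundamental_parallelepiped
    using assms by (rule lattice_basis_abs_det_unique)
  then show "lattice_det L = measure lebesgue (fundamental_parallelepiped M)"
    by (simp add: measure_fundamental_parallelepiped)
qed

end

theory Submission
  imports Defs
begin

text \<open>Changing \<open>f\<close> and \<open>g\<close> on null sets affects neither \<open>f * g\<close> nor the transforms, so they may be
  taken to be Borel, bounded and supported in a ball. Then \<open>h = f * g\<close> is a locally uniform limit of
  convolutions with continuous functions, hence continuous, and Fubini gives \<open>h^ = f^ g^\<close>. Bessel's
  inequality makes \<open>f^\<close> and \<open>g^\<close> square summable over the dual lattice, so \<open>h^\<close> is absolutely summable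
  there. The periodization of \<open>h\<close> and its Fourier series are therefore both continuous and periodic,
  with the same Fourier coefficients, and they agree by uniqueness: a continuous periodic function
  with vanishing coefficients is orthogonal to the powers of a trigonometric polynomial with a
  single peak in each cell, so it vanishes at the peak.\<close>

subsection \<open>Convolution of bounded functions with bounded support\<close>

text \<open>The identity is claimed at every point, so agreement in L^2 or almost everywhere would
  not be enough; this is why both sides must be continuous before they are compared. For a merely
  bounded measurable \<open>f\<close> the transform need not be absolutely summable over the dual
  lattice: for an interval it typically decays only like 1/|k|. The product of two square summable
  transforms is absolutely summable, and this is what the convolution structure buys. Borel
  representatives matter because \<open>f t * g (x - t)\<close> has to be jointly measurable for
  Fubini.

  The peaking polynomial is the product of sin^2(pi t_i) over the coordinates t_i in a lattice
  basis. Its frequencies are combinations of the rows of \<open>matrix_inv M\<close> with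
  coefficients -1, 0, 1, hence lie in the dual lattice. Its values lie between 0 and 1, with the
  value 1 where all t_i = 1/2. A peak in the middle of the cell, and not at a lattice point, keeps a
  whole ball around it inside the half-open cell.\<close>

lemma lborel_distr_reflect:
  fixes a :: "'a::euclidean_space"
  shows "distr lborel borel (\<lambda>x. a - x) = lborel"
  using lborel_affine[of "- 1" a] by (simp add: density_1)

lemma lborel_integral_translate:
  fixes f :: "'a::euclidean_space \<Rightarrow> 'b::{banach, second_countable_topology}"
  assumes [measurable]: "f \<in> borel_measurable borel"
  shows "(LINT x|lborel. f (x + a)) = (LINT x|lborel. f x)"
  by (subst (2) lborel_distr_plus[of a, symmetric], subst integral_distr) (auto simp: add.commute)

lemma lborel_integral_reflect:
  fixes f :: "'a::euclidean_space \<Rightarrow> 'b::{banach, second_countable_topology}"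
  assumes [measurable]: "f \<in> borel_measurable borel"
  shows "(LINT x|lborel. f (a - x)) = (LINT x|lborel. f x)"
  by (subst (2) lborel_distr_reflect[of a, symmetric], subst integral_distr) auto

lemma lborel_integrable_translate:
  fixes f :: "'a::euclidean_space \<Rightarrow> 'b::{banach, second_countable_topology}"
  assumes "integrable lborel f"
  shows "integrable lborel (\<lambda>x. f (x + a))"
proof -
  have [measurable]: "f \<in> borel_measurable borel" using assms by auto
  have "integrable (distr lborel borel ((+) a)) f"
    using assms by (simp add: lborel_distr_plus)
  then show ?thesis by (subst (asm) integrable_distr_eq) (auto simp: add.commute)
qed

text \<open>Reflections preserve Lebesgue measure, hence null sets. This lets \<open>g\<close> be
  modified on a null set inside \<open>\<lambda>t. g (x - t)\<close> for each fixed
  \<open>x\<close>.\<close>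

lemma AE_lborel_reflect:
  fixes a :: "'a::euclidean_space"
  assumes "AE x in lborel. P x"
  shows "AE x in lborel. P (a - x)"
proof -
  obtain N where N: "N \<in> null_sets lborel" "{x. \<not> P x} \<subseteq> N"
    using assms by (auto simp: eventually_ae_filter)
  have m: "(\<lambda>x. a - x) \<in> measurable lborel borel" by simp
  have "AE x in distr lborel borel (\<lambda>x. a - x). x \<notin> N"
    using N(1) by (simp add: lborel_distr_reflect AE_not_in)
  then have "AE x in lborel. a - x \<notin> N"
    using N(1) by (subst (asm) AE_distr_iff[OF m]) (auto simp: null_sets_def)
  then show ?thesis by eventually_elim (use N(2) in blast)
qed

text \<open>Borel rather than Lebesgue measurability, so that composition with
  \<open>\<lambda>(t, x). x - t\<close> stays measurable. The class is closed under convolution, so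
  \<open>f * g\<close> can be fed back into the same lemmas.\<close>

definition bounded_supported :: "(real^'d \<Rightarrow> complex) \<Rightarrow> bool" where
  "bounded_supported f \<longleftrightarrow> f \<in> borel_measurable borel \<and> bounded (range f) \<and> bounded {x. f x \<noteq> 0}"

lemma bounded_supportedD:
  assumes "bounded_supported f"
  obtains C R where "C > 0" "R > 0" "\<And>x. norm (f x) \<le> C" "\<And>x. f x \<noteq> 0 \<Longrightarrow> norm x \<le> R"
  using assms by (auto simp: bounded_supported_def bounded_pos)

lemma integrable_indicator_cball:
  "integrable lborel (indicator (cball a r) :: 'a::euclidean_space \<Rightarrow> real)"
  by (intro integrable_real_indicator) (use emeasure_bounded_finite[of "cball a r"] in \<open>auto simp: less_top\<close>)

lemma integrable_mult_bounded_supported: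
  fixes f :: "real^'d \<Rightarrow> complex"
  assumes "bounded_supported f" and [measurable]: "g \<in> borel_measurable borel"
    and "\<And>x. norm (g x) \<le> B"
  shows "integrable lborel (\<lambda>x. f x * g x)"
proof -
  obtain C R where CR: "C > 0" "\<And>x. norm (f x) \<le> C" "\<And>x. f x \<noteq> 0 \<Longrightarrow> norm x \<le> R"
    using bounded_supportedD[OF assms(1)] by metis
  have [measurable]: "f \<in> borel_measurable borel" using assms(1) by (simp add: bounded_supported_def)
  show ?thesis
  proof (rule Bochner_Integration.integrable_bound)
    show "integrable lborel (\<lambda>x::real^'d. C * B * indicator (cball 0 R) x :: real)"
      by (intro integrable_mult_right integrable_indicator_cball)
    show "AE x in lborel. norm (f x * g x) \<le> norm (C * B * indicator (cball 0 R) x :: real)"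
    proof (rule AE_I2)
      fix x
      have "B \<ge> 0" using assms(3)[of x] norm_ge_zero order_trans by blast
      then show "norm (f x * g x) \<le> norm (C * B * indicator (cball 0 R) x :: real)"
        using CR(1) CR(2)[of x] CR(3)[of x] assms(3)[of x]
        by (cases "f x = 0") (auto simp: norm_mult indicator_def intro!: mult_mono)
    qed
  qed simp
qed

lemma integrable_bounded_supported:
  "bounded_supported f \<Longrightarrow> integrable lborel f"
  using integrable_mult_bounded_supported[of f "\<lambda>_. 1" 1] by simp

definition lborel_convolution :: "(real^'d \<Rightarrow> complex) \<Rightarrow> (real^'d \<Rightarrow> complex) \<Rightarrow> real^'d \<Rightarrow> complex" where
  "lborel_convolution f g x = (LINT t|lborel. f t * g (x - t))"

text \<open>Dominated convergence with majorant \<open>norm (f t) * B\<close>. The support of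
  \<open>g\<close> is unrestricted because the lemma is applied to continuous approximants, which
  may be nonzero far away.\<close>

lemma continuous_on_lborel_convolution_continuous:
  fixes f g :: "real^'d \<Rightarrow> complex"
  assumes f: "bounded_supported f" and g: "continuous_on UNIV g" "\<And>x. norm (g x) \<le> B"
  shows "continuous_on UNIV (lborel_convolution f g)"
proof -
  have [measurable]: "f \<in> borel_measurable borel" using f by (simp add: bounded_supported_def)
  have [measurable]: "g \<in> borel_measurable borel" using g by (simp add: borel_measurable_continuous_onI)
  have "B \<ge> 0" using g(2)[of 0] norm_ge_zero order_trans by blast
  have intB: "integrable lborel (\<lambda>t. norm (f t) * B)"
    using integrable_bounded_supported[OF f] by (intro integrable_mult_left integrable_norm)
  show ?thesis
    unfolding lborel_convolution_def continuous_on_sequentially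
  proof (intro ballI allI impI)
    fix u :: "nat \<Rightarrow> real^'d" and a
    assume u: "(\<forall>n. u n \<in> UNIV) \<and> u \<longlonglongrightarrow> a"
    show "((\<lambda>x. LINT t|lborel. f t * g (x - t)) \<circ> u) \<longlonglongrightarrow> (LINT t|lborel. f t * g (a - t))"
      unfolding o_def
    proof (rule integral_dominated_convergence[OF _ _ intB])
      show "AE t in lborel. (\<lambda>n. f t * g (u n - t)) \<longlonglongrightarrow> f t * g (a - t)"
      proof (rule AE_I2)
        fix t
        have "(\<lambda>n. g (u n - t)) \<longlonglongrightarrow> g (a - t)"
          by (rule continuous_on_tendsto_compose[OF g(1)]) (use u in \<open>auto intro!: tendsto_intros\<close>)
        then show "(\<lambda>n. f t * g (u n - t)) \<longlonglongrightarrow> f t * g (a - t)" by (intro tendsto_intros)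
      qed
      show "AE t in lborel. norm (f t * g (u i - t)) \<le> norm (f t) * B" for i
        using g(2) by (auto simp: norm_mult intro!: mult_left_mono)
    qed auto
  qed
qed

text \<open>For \<open>x\<close> in a ball of radius \<open>K\<close>, replacing \<open>g\<close> by
  an approximant \<open>q n\<close> changes the convolution by at most \<open>C\<close> times the
  L^1 distance of \<open>q n\<close> and \<open>g\<close> on one fixed ball. Almost everywhere
  convergence of the \<open>q n\<close>, together with their common bound, thus becomes uniform
  convergence of the convolutions on bounded sets.\<close>

lemma continuous_on_lborel_convolution:
  fixes f g :: "real^'d \<Rightarrow> complex"
  assumes f: "bounded_supported f" and g: "bounded_supported g"
  shows "continuous_on UNIV (lborel_convolution f g)"
proof -
  obtain C R where CR: "C > 0" "R > 0" "\<And>x. norm (f x) \<le> C" "\<And>x. f x \<noteq> 0 \<Longrightarrow> norm x \<le> R"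
    using bounded_supportedD[OF f] by metis
  obtain B Q where BQ: "B > 0" "Q > 0" "\<And>x. norm (g x) \<le> B" "\<And>x. g x \<noteq> 0 \<Longrightarrow> norm x \<le> Q"
    using bounded_supportedD[OF g] by metis
  have [measurable]: "f \<in> borel_measurable borel" "g \<in> borel_measurable borel"
    using f g by (simp_all add: bounded_supported_def)
  \<comment> \<open>\<open>measurable_on\<close> provides continuous functions that converge to
    \<open>g\<close> pointwise off a negligible set.\<close>
  have "g measurable_on UNIV"
    by (rule lebesgue_measurable_imp_measurable_on) (auto intro: measurable_completion)
  then obtain N p where N: "negligible N" and p: "\<And>n. continuous_on UNIV (p n)"
     and plim: "\<And>x. x \<notin> N \<Longrightarrow> (\<lambda>n. p n x) \<longlonglongrightarrow> g x"
    unfolding measurable_on_def by auto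
  \<comment> \<open>a continuous retraction onto the ball of radius \<open>B\<close>, keeping the approximants of \<open>g\<close> bounded\<close>
  define clamp where "clamp z = complex_of_real (B / max B (norm z)) * z" for z :: complex
  have clamp_cont: "continuous_on UNIV clamp"
    unfolding clamp_def using BQ(1) by (intro continuous_intros) (auto simp: max_def)
  have clamp_le: "norm (clamp z) \<le> B" for z
    using BQ(1) by (cases "norm z = 0") (auto simp: clamp_def norm_mult norm_divide max_def)
  have clamp_id: "clamp z = z" if "norm z \<le> B" for z
    using BQ(1) that by (simp add: clamp_def max_def)
  define q where "q n x = clamp (p n x)" for n x
  have q_cont: "continuous_on UNIV (q n)" for n
    unfolding q_def by (rule continuous_on_compose2[OF clamp_cont p]) auto
  have q_le: "norm (q n x) \<le> B" for n x by (simp add: q_def clamp_le)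
  have [measurable]: "q n \<in> borel_measurable borel" for n
    by (rule borel_measurable_continuous_onI[OF q_cont])
  have qlim: "(\<lambda>n. q n x) \<longlonglongrightarrow> g x" if "x \<notin> N" for x
    using continuous_on_tendsto_compose[OF clamp_cont plim[OF that]] clamp_id[OF BQ(3)]
    by (simp add: q_def)
  have "N \<in> null_sets lebesgue" using N by (simp add: negligible_iff_null_sets)
  then have "AE x in lebesgue. x \<notin> N" by (rule AE_not_in)
  then have aeN: "AE x in lborel. x \<notin> N" by (simp add: AE_completion_iff)
  have local: "continuous_on (ball 0 K) (lborel_convolution f g)" for K
  proof -
    \<comment> \<open>This ball contains every \<open>x - t\<close> with \<open>norm x < K\<close>
      and \<open>norm t \<le> R\<close>, that is, every argument of \<open>g\<close> that matters
      for \<open>x\<close> in \<open>ball 0 K\<close>.\<close>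
    define E where "E = cball (0::real^'d) (K + R)"
    have [measurable]: "E \<in> sets borel" by (simp add: E_def)
    define \<delta> where "\<delta> n = (LINT x|lborel. indicator E x * norm (q n x - g x))" for n
    have bnd: "norm (q n x - g x) \<le> 2 * B" for n x
      using norm_triangle_ineq4[of "q n x" "g x"] q_le[of n x] BQ(3)[of x] by simp
    have intE: "integrable lborel (\<lambda>x. indicator E x * norm (q n x - g x))" for n
    proof (rule Bochner_Integration.integrable_bound)
      show "integrable lborel (\<lambda>x. indicator E x * (2 * B))"
        unfolding E_def by (intro integrable_mult_left integrable_indicator_cball)
      show "AE x in lborel. norm (indicator E x * norm (q n x - g x)) \<le> norm (indicator E x * (2 * B))"
        using bnd BQ(1) by (intro AE_I2) (auto simp: indicator_def)
    qed simp
    have "(\<lambda>n. \<delta> n) \<longlonglongrightarrow> (LINT x|(lborel :: (real^'d) measure). (0::real))"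
      unfolding \<delta>_def
    proof (rule integral_dominated_convergence)
      show "integrable lborel (\<lambda>x. indicator E x * (2 * B))"
        unfolding E_def by (intro integrable_mult_left integrable_indicator_cball)
      show "AE x in lborel. norm (indicator E x * norm (q n x - g x)) \<le> indicator E x * (2 * B)" for n
        using bnd BQ(1) by (intro AE_I2) (auto simp: indicator_def)
      show "AE x in lborel. (\<lambda>n. indicator E x * norm (q n x - g x)) \<longlonglongrightarrow> 0"
        using aeN
      proof eventually_elim
        fix x assume "x \<notin> N"
        then have "(\<lambda>n. norm (q n x - g x)) \<longlonglongrightarrow> norm (g x - g x)"
          by (intro tendsto_intros qlim)
        then show "(\<lambda>n. indicator E x * norm (q n x - g x)) \<longlonglongrightarrow> 0"
          using tendsto_mult_left[of _ 0 _ "indicator E x"] by fastforce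
      qed
    qed auto
    then have \<delta>0: "\<delta> \<longlonglongrightarrow> 0" by simp
    have close: "norm (lborel_convolution f (q n) x - lborel_convolution f g x) \<le> C * \<delta> n" if x: "x \<in> ball 0 K" for n x
    proof -
      have i1: "integrable lborel (\<lambda>t. f t * q n (x - t))" for n
        by (rule integrable_mult_bounded_supported[OF f, of _ B]) (auto simp: q_le)
      have i2: "integrable lborel (\<lambda>t. f t * g (x - t))" for n
        by (rule integrable_mult_bounded_supported[OF f, of _ B]) (auto simp: BQ)
      have "lborel_convolution f (q n) x - lborel_convolution f g x = (LINT t|lborel. f t * q n (x - t) - f t * g (x - t))"
        unfolding lborel_convolution_def by (rule Bochner_Integration.integral_diff[symmetric]) (fact i1 i2)+
      also have "norm \<dots> \<le> (LINT t|lborel. norm (f t * q n (x - t) - f t * g (x - t)))"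
        by (rule integral_norm_bound)
      also have "\<dots> \<le> (LINT t|lborel. C * (indicator E (x - t) * norm (q n (x - t) - g (x - t))))"
      proof (rule integral_mono)
        show "integrable lborel (\<lambda>t. norm (f t * q n (x - t) - f t * g (x - t)))"
          using i1 i2 by (intro integrable_norm Bochner_Integration.integrable_diff)
        have "integrable (distr lborel borel (\<lambda>t. x - t)) (\<lambda>t. indicator E t * norm (q n t - g t))"
          using intE by (simp add: lborel_distr_reflect)
        then show "integrable lborel (\<lambda>t. C * (indicator E (x - t) * norm (q n (x - t) - g (x - t))))"
          by (subst (asm) integrable_distr_eq) auto
        fix t
        show "norm (f t * q n (x - t) - f t * g (x - t)) \<le> C * (indicator E (x - t) * norm (q n (x - t) - g (x - t)))"
        proof (cases "f t = 0")
          case False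
          then have "norm t \<le> R" by (rule CR(4))
          then have "x - t \<in> E" using x norm_triangle_ineq4[of x t] by (auto simp: E_def)
          then show ?thesis using CR(3)[of t]
            by (auto simp: norm_mult right_diff_distrib[symmetric] intro!: mult_right_mono)
        qed (use CR(1) in auto)
      qed
      also have "\<dots> = C * \<delta> n"
        unfolding \<delta>_def using lborel_integral_reflect[of "\<lambda>t. indicator E t * norm (q n t - g t)" x]
        by simp
      finally show ?thesis .
    qed
    have "uniform_limit (ball 0 K) (\<lambda>n. lborel_convolution f (q n)) (lborel_convolution f g) sequentially"
    proof (rule uniform_limitI)
      fix e :: real assume "e > 0"
      have "(\<lambda>n. C * \<delta> n) \<longlonglongrightarrow> C * 0" by (intro tendsto_intros \<delta>0)
      then have "eventually (\<lambda>n. C * \<delta> n < e) sequentially"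
        using \<open>e > 0\<close> by (simp add: order_tendstoD)
      then show "\<forall>\<^sub>F n in sequentially. \<forall>x\<in>ball 0 K. dist (lborel_convolution f (q n) x) (lborel_convolution f g x) < e"
        by eventually_elim (auto simp: dist_norm intro!: le_less_trans[OF close])
    qed
    then show ?thesis
      by (rule uniform_limit_theorem[rotated])
         (auto intro!: always_eventually continuous_on_subset[OF continuous_on_lborel_convolution_continuous[OF f q_cont q_le]])
  qed
  have "isCont (lborel_convolution f g) x" for x
    using local[of "norm x + 1"] by (simp add: continuous_on_eq_continuous_at)
  then show ?thesis by (simp add: continuous_at_imp_continuous_on)
qed

lemma lborel_convolution_nonzero:
  assumes "lborel_convolution f g x \<noteq> 0" "\<And>x. f x \<noteq> 0 \<Longrightarrow> norm x \<le> R" "\<And>x. g x \<noteq> 0 \<Longrightarrow> norm x \<le> Q"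
  shows "norm x \<le> R + Q"
proof (rule ccontr)
  assume *: "\<not> norm x \<le> R + Q"
  have "f t * g (x - t) = 0" for t
    using * assms(2)[of t] assms(3)[of "x - t"] norm_triangle_ineq[of t "x - t"] by fastforce
  then have "(\<lambda>t. f t * g (x - t)) = (\<lambda>_. 0)" by blast
  then show False using assms(1) by (simp add: lborel_convolution_def)
qed

text \<open>Boundedness comes from continuity: the convolution vanishes outside a compact
  ball.\<close>

lemma bounded_supported_lborel_convolution:
  fixes f g :: "real^'d \<Rightarrow> complex"
  assumes f: "bounded_supported f" and g: "bounded_supported g"
  shows "bounded_supported (lborel_convolution f g)"
proof -
  obtain C R where CR: "C > 0" "R > 0" "\<And>x. norm (f x) \<le> C" "\<And>x. f x \<noteq> 0 \<Longrightarrow> norm x \<le> R"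
    using bounded_supportedD[OF f] by metis
  obtain B Q where BQ: "B > 0" "Q > 0" "\<And>x. norm (g x) \<le> B" "\<And>x. g x \<noteq> 0 \<Longrightarrow> norm x \<le> Q"
    using bounded_supportedD[OF g] by metis
  have supp: "{x. lborel_convolution f g x \<noteq> 0} \<subseteq> cball 0 (R + Q)"
    using lborel_convolution_nonzero[OF _ CR(4) BQ(4)] by auto
  have cont: "continuous_on UNIV (lborel_convolution f g)" by (rule continuous_on_lborel_convolution[OF f g])
  have "compact (lborel_convolution f g ` cball 0 (R + Q))"
    by (intro compact_continuous_image continuous_on_subset[OF cont]) auto
  \<comment> \<open>The inserted \<open>0\<close> is the value taken outside the ball.\<close>
  then have "bounded (insert 0 (lborel_convolution f g ` cball 0 (R + Q)))"
    by (simp add: compact_imp_bounded)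
  then have "bounded (range (lborel_convolution f g))"
    by (rule bounded_subset) (use supp in auto)
  then show ?thesis
    using bounded_subset[OF bounded_cball supp] borel_measurable_continuous_onI[OF cont]
    by (simp add: bounded_supported_def)
qed

subsection \<open>Characters and fundamental domains of a lattice\<close>

lemma finite_Ints_vectors:
  "finite {k :: real^'d. \<forall>i. k $ i \<in> \<int> \<and> \<bar>k $ i\<bar> \<le> R}"
proof (rule finite_subset)
  show "{k :: real^'d. \<forall>i. k $ i \<in> \<int> \<and> \<bar>k $ i\<bar> \<le> R} \<subseteq> vec_lambda ` (PiE UNIV (\<lambda>_. {x\<in>\<int>. \<bar>x\<bar> \<le> R}))"
  proof
    fix k :: "real^'d" assume "k \<in> {k. \<forall>i. k $ i \<in> \<int> \<and> \<bar>k $ i\<bar> \<le> R}"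
    then show "k \<in> vec_lambda ` (PiE UNIV (\<lambda>_. {x\<in>\<int>. \<bar>x\<bar> \<le> R}))"
      by (intro image_eqI[of _ _ "vec_nth k"]) (auto simp: vec_lambda_eta)
  qed
  show "finite ((vec_lambda :: _ \<Rightarrow> real^'d) ` (PiE UNIV (\<lambda>_. {x\<in>\<int>. \<bar>x\<bar> \<le> R})))"
    by (intro finite_imageI finite_PiE finite_abs_int_segment) auto
qed

definition character :: "real^'d \<Rightarrow> real^'d \<Rightarrow> complex" where
  "character \<xi> x = cis (2 * pi * (\<xi> \<bullet> x))"

lemma character_zero [simp]: "character 0 x = 1"
  and norm_character [simp]: "norm (character \<xi> x) = 1"
  and cnj_character: "cnj (character \<xi> x) = character (- \<xi>) x"
  and character_minus: "character (- \<xi>) x = character \<xi> (- x)"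
  and character_add: "character (\<xi> + \<eta>) x = character \<xi> x * character \<eta> x"
  and character_add_right: "character \<xi> (x + y) = character \<xi> x * character \<xi> y"
  by (simp_all add: character_def cis_cnj cis_mult algebra_simps)

lemma character_eq_exp:
  "exp (2 * complex_of_real pi * \<i> * complex_of_real (\<xi> \<bullet> x)) = character \<xi> x"
  "exp (- 2 * complex_of_real pi * \<i> * complex_of_real (x \<bullet> \<xi>)) = character (- \<xi>) x"
  by (simp_all add: character_def cis_conv_exp mult_ac inner_commute)

lemma continuous_on_character [continuous_intros]: "continuous_on A (character \<xi>)"
  unfolding character_def[abs_def] cis_conv_exp by (intro continuous_intros)

lemma borel_measurable_character [measurable]: "character \<xi> \<in> borel_measurable borel"
  by (intro borel_measurable_continuous_onI continuous_on_character)

text \<open>\<open>full_rank_lattice\<close> only asserts that a basis exists. With \<open>M\<close>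
  fixed, points get coordinates in which the lattice is the set of integer vectors and the cell is
  the half-open unit cube.\<close>

locale lattice_with_basis =
  fixes M :: "real^'d^'d" and L :: "(real^'d) set"
  assumes basis: "lattice_basis M L"
begin

definition coords :: "real^'d \<Rightarrow> real^'d" where "coords x = matrix_inv M *v x"

abbreviation "D \<equiv> fundamental_parallelepiped M"

abbreviation "vol \<equiv> lattice_det L"

lemma invertible_M: "invertible M"
  using basis by (simp add: lattice_basis_def)

lemma M_coords [simp]: "M *v coords x = x"
  and coords_M [simp]: "coords (M *v x) = x"
proof -
  have "M ** matrix_inv M = mat 1 \<and> matrix_inv M ** M = mat 1"
    unfolding matrix_inv_def using invertible_M unfolding invertible_def by (rule someI_ex)
  then show "M *v coords x = x" "coords (M *v x) = x"
    by (simp_all add: coords_def matrix_vector_mul_assoc)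
qed

lemma linear_coords: "linear coords"
  unfolding coords_def by (rule matrix_vector_mul_linear)

lemma continuous_on_coords [continuous_intros]: "continuous_on A coords"
  using linear_coords by (simp add: linear_continuous_on linear_conv_bounded_linear)

lemmas coords_simps = linear_add[OF linear_coords] linear_diff[OF linear_coords] linear_neg[OF linear_coords]

lemma coords_inject: "coords x = coords y \<longleftrightarrow> x = y"
  by (metis M_coords)

lemma coords_nth: "coords x $ i = matrix_inv M $ i \<bullet> x"
  by (simp add: coords_def matrix_vector_mult_def inner_vec_def)

lemma mem_L: "n \<in> L \<longleftrightarrow> (\<forall>i. coords n $ i \<in> \<int>)"
proof -
  have "L = {M *v k |k. \<forall>i. k $ i \<in> \<int>}" using basis by (simp add: lattice_basis_def)
  then show ?thesis by (auto intro: exI[of _ "coords n"])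
qed

lemma mem_D: "x \<in> D \<longleftrightarrow> (\<forall>i. 0 \<le> coords x $ i \<and> coords x $ i < 1)"
  by (auto simp: fundamental_parallelepiped_def intro: exI[of _ "coords x"])

lemma L_closed: "0 \<in> L" "n \<in> L \<Longrightarrow> m \<in> L \<Longrightarrow> n + m \<in> L" "n \<in> L \<Longrightarrow> m \<in> L \<Longrightarrow> n - m \<in> L" "n \<in> L \<Longrightarrow> - n \<in> L"
  by (auto simp: mem_L coords_simps linear_0[OF linear_coords])

lemma D_borel [measurable]: "D \<in> sets borel"
proof -
  have [measurable]: "coords \<in> borel_measurable borel"
    by (intro borel_measurable_continuous_onI continuous_on_coords)
  have "D = (\<Inter>i\<in>UNIV. {x\<in>space borel. 0 \<le> coords x $ i \<and> coords x $ i < 1})"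
    by (auto simp: mem_D)
  also have "\<dots> \<in> sets borel"
    by (intro sets.finite_INT) auto
  finally show ?thesis .
qed

lemma D_sub_compact: "D \<subseteq> (*v) M ` cbox 0 1"
  by (intro subsetI image_eqI[of _ _ "coords _"]) (auto simp: mem_D mem_box_cart less_imp_le)

lemma compact_M_cbox: "compact ((*v) M ` cbox 0 1)"
  by (intro compact_continuous_image linear_continuous_on matrix_vector_mul_bounded_linear) auto

lemma bounded_D: "bounded D"
  using D_sub_compact compact_M_cbox bounded_subset compact_imp_bounded by blast

lemma measure_D: "measure lborel D = vol"
  using measure_fundamental_parallelepiped[of M] lattice_det_eq[OF basis]
  by (simp add: measure_completion)

lemma vol_pos: "vol > 0"
  using lattice_det_eq(2)[OF basis] invertible_M by (simp add: invertible_det_nz)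

lemma D_finite: "emeasure lborel D < \<infinity>"
  using emeasure_bounded_finite[OF bounded_D] .

section \<open>Tiling of space by the cells \<open>n + D\<close>, and cutting integrals along
  them\<close>

lemma cell_exists: "\<exists>n\<in>L. x - n \<in> D"
proof
  let ?n = "M *v (\<chi> i. of_int \<lfloor>coords x $ i\<rfloor>)"
  show "?n \<in> L" by (simp add: mem_L)
  show "x - ?n \<in> D" by (auto simp: mem_D coords_simps) linarith
qed

text \<open>The coordinates of \<open>n\<close> and \<open>m\<close> differ by integers, and these
  have absolute value less than 1 because the cell is half-open.\<close>

lemma cell_unique:
  assumes "n \<in> L" "m \<in> L" "x - n \<in> D" "x - m \<in> D"
  shows "n = m"
proof -
  have "coords n $ i = coords m $ i" for i
  proof -
    obtain a b where ab: "coords n $ i = of_int a" "coords m $ i = of_int b"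
      using assms(1,2) by (auto simp: mem_L Ints_def dest!: spec[of _ i])
    have "\<bar>coords n $ i - coords m $ i\<bar> < 1"
      using spec[OF assms(3)[unfolded mem_D], of i] spec[OF assms(4)[unfolded mem_D], of i]
      by (simp add: coords_simps) linarith
    then have "\<bar>a - b\<bar> < 1" unfolding ab by linarith
    then show ?thesis using ab by simp
  qed
  then have "coords n = coords m" by (simp add: vec_eq_iff)
  then show ?thesis by (simp add: coords_inject)
qed

lemma finite_L_bounded:
  assumes "bounded B"
  shows "finite {n\<in>L. n \<in> B}"
proof -
  have "bounded (coords ` B)"
    using assms linear_coords by (simp add: bounded_linear_image linear_conv_bounded_linear)
  then obtain R where R: "\<And>x. x \<in> B \<Longrightarrow> norm (coords x) \<le> R"
    by (auto simp: bounded_iff)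
  have "coords ` {n\<in>L. n \<in> B} \<subseteq> {k. \<forall>i. k $ i \<in> \<int> \<and> \<bar>k $ i\<bar> \<le> R}"
    using R component_le_norm_cart order_trans by (fastforce simp: mem_L)
  then have "finite (coords ` {n\<in>L. n \<in> B})"
    using finite_Ints_vectors finite_subset by blast
  then show ?thesis
    by (rule finite_imageD) (auto simp: inj_on_def coords_inject)
qed

definition cells :: "(real^'d) set \<Rightarrow> (real^'d) set" where
  "cells B = {n\<in>L. \<exists>x\<in>B. x - n \<in> D}"

lemma finite_cells:
  assumes "bounded B" shows "finite (cells B)"
proof -
  obtain b where b: "\<And>x. x \<in> B \<Longrightarrow> norm x \<le> b" using assms by (auto simp: bounded_iff)
  obtain d where d: "\<And>x. x \<in> D \<Longrightarrow> norm x \<le> d" using bounded_D by (auto simp: bounded_iff)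
  have "cells B \<subseteq> {n\<in>L. n \<in> cball 0 (b + d)}"
  proof
    fix n assume "n \<in> cells B"
    then obtain x where x: "n \<in> L" "x \<in> B" "x - n \<in> D" by (auto simp: cells_def)
    have "norm n = norm (x - (x - n))" by simp
    also have "\<dots> \<le> b + d" using norm_triangle_ineq4[of x "x - n"] b[OF x(2)] d[OF x(3)] by linarith
    finally show "n \<in> {n\<in>L. n \<in> cball 0 (b + d)}" using x by simp
  qed
  then show ?thesis using finite_L_bounded[OF bounded_cball] finite_subset by blast
qed

lemma cells_subset: "cells B \<subseteq> L"
  by (auto simp: cells_def)

text \<open>Exactly one cell \<open>n + D\<close> contains \<open>x\<close>, and the last hypothesis
  puts its \<open>n\<close> into \<open>S\<close>. This is a partition of unity with finitely many
  terms.\<close>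

lemma sum_indicator_cells:
  assumes "finite S" "S \<subseteq> L" "\<And>n. n \<in> L \<Longrightarrow> x - n \<in> D \<Longrightarrow> n \<in> S"
  shows "(\<Sum>n\<in>S. indicator D (x - n)) = (1::real)"
proof -
  obtain n where n: "n \<in> L" "x - n \<in> D" using cell_exists by blast
  have "(\<Sum>m\<in>S. indicator D (x - m)) = (\<Sum>m\<in>S. if m = n then 1 else (0::real))"
    using assms(2) cell_unique[OF _ n(1) _ n(2)] n(2)
    by (intro sum.cong refl) (auto simp: indicator_def)
  then show ?thesis using assms(1) assms(3)[OF n] by simp
qed

text \<open>Insert the partition of unity and translate each piece back to \<open>D\<close>. The
  hypothesis on \<open>S\<close> says that it indexes every cell meeting the set where
  \<open>h\<close> is nonzero, so the sum is finite and commutes with the integral.\<close>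

lemma integral_eq_sum_cells:
  fixes h :: "real^'d \<Rightarrow> complex"
  assumes h: "integrable lborel h" and S: "finite S" "S \<subseteq> L"
    and supp: "\<And>x n. h x \<noteq> 0 \<Longrightarrow> n \<in> L \<Longrightarrow> x - n \<in> D \<Longrightarrow> n \<in> S"
  shows "(LINT x|lborel. h x) = (\<Sum>n\<in>S. LINT x:D|lborel. h (x + n))"
proof -
  have [measurable]: "h \<in> borel_measurable borel" using h by auto
  have "h x = (\<Sum>n\<in>S. indicator D (x - n) *\<^sub>R h x)" for x
    using sum_indicator_cells[OF S supp, of x]
    by (cases "h x = 0") (simp_all flip: scaleR_sum_left)
  then have "(LINT x|lborel. h x) = (LINT x|lborel. (\<Sum>n\<in>S. indicator D (x - n) *\<^sub>R h x))"
    by (rule Bochner_Integration.integral_cong[OF refl])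
  also have "\<dots> = (\<Sum>n\<in>S. LINT x|lborel. indicator D (x - n) *\<^sub>R h x)"
  proof (rule Bochner_Integration.integral_sum)
    fix n
    show "integrable lborel (\<lambda>x. indicator D (x - n) *\<^sub>R h x)"
      by (rule Bochner_Integration.integrable_bound[OF h]) (auto simp: indicator_def)
  qed
  also have "\<dots> = (\<Sum>n\<in>S. LINT x:D|lborel. h (x + n))"
  proof (intro sum.cong refl)
    fix n
    show "(LINT x|lborel. indicator D (x - n) *\<^sub>R h x) = (LINT x:D|lborel. h (x + n))"
      unfolding set_lebesgue_integral_def
      by (subst lborel_integral_translate[of "\<lambda>x. indicator D (x - n) *\<^sub>R h x" n, symmetric]) auto
  qed
  finally show ?thesis .
qed

lemma set_integrable_D:
  fixes q :: "real^'d \<Rightarrow> 'b::{banach, second_countable_topology}"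
  assumes [measurable]: "q \<in> borel_measurable borel" and "\<And>x. norm (q x) \<le> B"
  shows "set_integrable lborel D q"
  unfolding set_integrable_def
  by (rule integrableI_bounded_set_indicator[of _ _ _ B]) (use D_finite assms(2) in auto)

definition periodic :: "(real^'d \<Rightarrow> complex) \<Rightarrow> bool" where
  "periodic q \<longleftrightarrow> (\<forall>x. \<forall>n\<in>L. q (x + n) = q x)"

text \<open>Restrict \<open>q\<close> to the translated cell \<open>a + D\<close>, cut this piece
  along the tiling and move the parts back to \<open>D\<close>. By periodicity they reassemble to
  \<open>q\<close>, since exactly one lattice translate of each point lies in
  \<open>a + D\<close>.\<close>

lemma periodic_integral_shift:
  assumes q: "periodic q" and [measurable]: "q \<in> borel_measurable borel" and B: "\<And>x. norm (q x) \<le> B"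
  shows "(LINT x:D|lborel. q (x + a)) = (LINT x:D|lborel. q x)"
proof -
  define h where "h x = indicator D (x - a) *\<^sub>R q x" for x
  define S where "S = cells ((+) a ` D)"
  have [measurable]: "h \<in> borel_measurable borel" unfolding h_def[abs_def] by measurable
  have S: "finite S" "S \<subseteq> L"
    unfolding S_def by (auto intro!: finite_cells bounded_translation bounded_D cells_subset)
  have inth: "integrable lborel h"
  proof -
    have "integrable lborel (\<lambda>x. indicator D x *\<^sub>R q (x + a))"
      using set_integrable_D[of "\<lambda>x. q (x + a)" B] B unfolding set_integrable_def by simp
    from lborel_integrable_translate[OF this, of "- a"] show ?thesis
      unfolding h_def[abs_def] by simp
  qed
  have "(LINT x:D|lborel. q (x + a)) = (LINT x|lborel. h (x + a))"
    by (simp add: set_lebesgue_integral_def h_def)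
  also have "\<dots> = (LINT x|lborel. h x)"
    by (rule lborel_integral_translate) simp
  also have "\<dots> = (\<Sum>n\<in>S. LINT x:D|lborel. h (x + n))"
  proof (rule integral_eq_sum_cells[OF inth S])
    fix x n assume "h x \<noteq> 0" "n \<in> L" "x - n \<in> D"
    then show "n \<in> S"
      by (auto simp: h_def S_def cells_def indicator_def image_iff intro!: bexI[of _ "x - a"] split: if_splits)
  qed
  also have "\<dots> = (LINT x:D|lborel. \<Sum>n\<in>S. h (x + n))"
    unfolding set_lebesgue_integral_def scaleR_sum_right
    by (intro Bochner_Integration.integral_sum[symmetric]
      integrable_mult_indicator lborel_integrable_translate inth) simp
  also have "\<dots> = (LINT x:D|lborel. q x)"
  proof (rule set_lebesgue_integral_cong)
    show "\<forall>x. x \<in> D \<longrightarrow> (\<Sum>n\<in>S. h (x + n)) = q x"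
    proof (intro allI impI)
      fix x assume x: "x \<in> D"
      have "(\<Sum>n\<in>S. h (x + n)) = (\<Sum>n\<in>S. indicator D (x + n - a)) *\<^sub>R q x"
        using S(2) q by (auto simp: h_def scaleR_sum_left periodic_def intro!: sum.cong)
      \<comment> \<open>The substitution \<open>m = - n\<close> brings the sum into the form of the
        partition of unity at the point \<open>x - a\<close>.\<close>
      also have "(\<Sum>n\<in>S. indicator D (x + n - a)) = (\<Sum>m\<in>uminus ` S. indicator D ((x - a) - m) :: real)"
        by (subst sum.reindex) (auto intro!: sum.cong simp: algebra_simps)
      also have "\<dots> = 1"
      proof (rule sum_indicator_cells)
        fix m assume m: "m \<in> L" "x - a - m \<in> D"
        have "- m \<in> S" unfolding S_def cells_def
          using m x L_closed(4) by (auto intro!: bexI[of _ "x - a - m"])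
        then show "m \<in> uminus ` S" by (rule image_eqI[rotated]) simp
      qed (use S L_closed(4) in auto)
      finally show "(\<Sum>n\<in>S. h (x + n)) = q x" by simp
    qed
  qed simp
  finally show ?thesis .
qed

lemma character_periodic:
  assumes "\<xi> \<in> dual_lattice L" "n \<in> L"
  shows "character \<xi> n = 1" "character \<xi> (x + n) = character \<xi> x"
proof -
  have "\<xi> \<bullet> n \<in> \<int>" using assms by (simp add: dual_lattice_def)
  then show *: "character \<xi> n = 1"
    by (simp add: character_def cis_multiple_2pi)
  show "character \<xi> (x + n) = character \<xi> x" by (simp add: character_add_right *)
qed

lemma dual_closed: "0 \<in> dual_lattice L" "\<xi> \<in> dual_lattice L \<Longrightarrow> \<eta> \<in> dual_lattice L \<Longrightarrow> \<xi> + \<eta> \<in> dual_lattice L"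
  "\<xi> \<in> dual_lattice L \<Longrightarrow> - \<xi> \<in> dual_lattice L"
  by (auto simp: dual_lattice_def inner_add_left)

text \<open>The rows of the inverse matrix form the dual basis: pairing them with a lattice vector
  gives its integer coordinates. They supply the frequencies of the peaking kernel.\<close>

lemma coord_functional_dual: "matrix_inv M $ i \<in> dual_lattice L"
  by (auto simp: dual_lattice_def coords_nth[symmetric] mem_L)

lemma integral_character:
  assumes "\<xi> \<in> dual_lattice L"
  shows "(LINT x:D|lborel. character \<xi> x) = (if \<xi> = 0 then complex_of_real vol else 0)"
proof (cases "\<xi> = 0")
  case True
  then show ?thesis using D_finite measure_D by (simp add: set_lebesgue_integral_def scaleR_conv_of_real)
next
  case False
  \<comment> \<open>translation by \<open>a\<close> preserves the integral but multiplies the integrand by \<open>- 1\<close>\<close>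
  define a where "a = (1 / (2 * (\<xi> \<bullet> \<xi>))) *\<^sub>R \<xi>"
  have "\<xi> \<bullet> a = 1 / 2" using False by (simp add: a_def)
  then have "2 * pi * (\<xi> \<bullet> a) = pi" by simp
  then have a: "character \<xi> a = - 1" by (simp only: character_def cis_pi)
  have "(LINT x:D|lborel. character \<xi> (x + a)) = (LINT x:D|lborel. character \<xi> x)"
    by (rule periodic_integral_shift[of _ 1]) (auto simp: periodic_def character_periodic[OF assms])
  moreover have "(LINT x:D|lborel. character \<xi> (x + a)) = - (LINT x:D|lborel. character \<xi> x)"
    by (simp add: character_add_right a set_lebesgue_integral_def)
  ultimately show ?thesis using False by (simp add: equal_neg_zero)
qed

end

subsection \<open>Uniqueness of Fourier coefficients\<close>

context lattice_with_basis
begin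

text \<open>A lattice translation moves every point into the closed parallelepiped, which is
  compact.\<close>

lemma periodic_continuous_bounded:
  assumes q: "periodic q" "continuous_on UNIV q"
  obtains B where "\<And>x. norm (q x) \<le> B"
proof -
  have "compact (q ` (*v) M ` cbox 0 1)"
    by (intro compact_continuous_image compact_M_cbox continuous_on_subset[OF q(2)]) auto
  then obtain B where B: "\<And>x. x \<in> (*v) M ` cbox 0 1 \<Longrightarrow> norm (q x) \<le> B"
    using compact_imp_bounded by (fastforce simp: bounded_iff)
  have "norm (q x) \<le> B" for x
  proof -
    obtain n where n: "n \<in> L" "x - n \<in> D" using cell_exists by blast
    have "q x = q (x - n)" using q(1) n(1) unfolding periodic_def by (metis diff_add_cancel)
    then show ?thesis using B n(2) D_sub_compact by auto
  qed
  then show ?thesis using that by blast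
qed

text \<open>All Fourier coefficients vanish; the sign of the frequency is immaterial as the dual
  lattice is symmetric. Continuity and periodicity are bundled in so that the class is stable under
  the operations that build trigonometric polynomials.\<close>

definition annihilated :: "(real^'d \<Rightarrow> complex) \<Rightarrow> bool" where
  "annihilated q \<longleftrightarrow> continuous_on UNIV q \<and> periodic q \<and>
     (\<forall>\<xi>\<in>dual_lattice L. (LINT x:D|lborel. q x * character \<xi> x) = 0)"

lemma periodic_continuous_set_integrable:
  assumes "continuous_on UNIV q" "periodic q"
  shows "set_integrable lborel D q"
proof -
  obtain B where "\<And>x. norm (q x) \<le> B" using periodic_continuous_bounded[OF assms(2,1)] by blast
  then show ?thesis by (rule set_integrable_D[OF borel_measurable_continuous_onI[OF assms(1)]])
qed

lemma periodic_character: "\<xi> \<in> dual_lattice L \<Longrightarrow> periodic (character \<xi>)"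
  by (simp add: periodic_def character_periodic)

lemma periodic_mult: "periodic p \<Longrightarrow> periodic q \<Longrightarrow> periodic (\<lambda>x. p x * q x)"
  by (simp add: periodic_def)

lemma annihilated_integrable:
  assumes "annihilated q" "\<xi> \<in> dual_lattice L"
  shows "set_integrable lborel D (\<lambda>x. q x * character \<xi> x)"
  using assms unfolding annihilated_def
  by (intro periodic_continuous_set_integrable continuous_intros periodic_mult periodic_character) auto

text \<open>Multiplication by a character only shifts the index of the coefficients by
  \<open>\<eta>\<close>. With sums and scalar multiples this covers multiplication by any
  trigonometric polynomial.\<close>

lemma annihilated_mult_character:
  assumes "annihilated q" "\<eta> \<in> dual_lattice L"
  shows "annihilated (\<lambda>x. q x * character \<eta> x)"
  using assms dual_closed(2)[OF assms(2)]
  by (auto simp: annihilated_def mult.assoc simp flip: character_add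
      intro!: continuous_intros periodic_mult periodic_character)

lemma annihilated_add:
  assumes "annihilated p" "annihilated q"
  shows "annihilated (\<lambda>x. p x + q x)"
  using assms annihilated_integrable[OF assms(1)] annihilated_integrable[OF assms(2)]
  by (auto simp: annihilated_def distrib_right periodic_def intro!: continuous_intros)

lemma annihilated_cmult:
  assumes "annihilated p"
  shows "annihilated (\<lambda>x. c * p x)"
  using assms
  by (auto simp: annihilated_def mult.assoc periodic_def intro!: continuous_intros)

text \<open>One-dimensional factor of the peaking kernel: it has period 1 in the i-th coordinate and
  reaches its maximum 1 exactly at the half-integers.\<close>

definition kernel_factor :: "'d \<Rightarrow> real^'d \<Rightarrow> real" where
  "kernel_factor i x = (sin (pi * coords x $ i))\<^sup>2"

lemma annihilated_kernel_factor:
  assumes "annihilated q"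
  shows "annihilated (\<lambda>x. q x * complex_of_real (kernel_factor i x))"
proof -
  let ?w = "matrix_inv M $ i"
  have w: "?w \<in> dual_lattice L" "- ?w \<in> dual_lattice L"
    using coord_functional_dual dual_closed(3) by auto
  \<comment> \<open>Double angle formula: the squared sine is (1 - cos)/2, and the cosine is the
    mean of two opposite characters.\<close>
  have factor: "complex_of_real (kernel_factor i x) = 1/2 - 1/4 * character ?w x - 1/4 * character (- ?w) x" for x
  proof -
    have "kernel_factor i x = (1 - cos (2 * pi * (?w \<bullet> x))) / 2"
      by (simp add: kernel_factor_def coords_nth[symmetric] mult.assoc cos_double_sin)
    then show ?thesis
      by (simp add: character_def complex_eq_iff)
  qed
  have *: "q x * complex_of_real (kernel_factor i x) =
      1/2 * q x + ((- 1/4) * (q x * character ?w x) + (- 1/4) * (q x * character (- ?w) x))" for x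
    unfolding factor by (simp add: algebra_simps)
  show ?thesis unfolding *
    by (intro annihilated_add annihilated_cmult annihilated_mult_character assms w)
qed

definition kernel :: "real^'d \<Rightarrow> real" where
  "kernel x = (\<Prod>i\<in>UNIV. kernel_factor i x)"

lemma annihilated_kernel_power:
  assumes "annihilated q"
  shows "annihilated (\<lambda>x. q x * complex_of_real (kernel x ^ k))"
proof -
  have prod: "annihilated (\<lambda>x. p x * complex_of_real (\<Prod>i\<in>I. kernel_factor i x))"
    if "finite I" "annihilated p" for I p
    using that(1)
  proof (induction I)
    case (insert i I)
    then show ?case using annihilated_kernel_factor[OF insert.IH, of i] by (simp add: mult_ac)
  qed (use that(2) in simp)
  show ?thesis
  proof (induction k)
    case (Suc k)
    then show ?case using prod[OF finite Suc] by (simp add: kernel_def mult_ac)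
  qed (use assms in simp)
qed

definition center :: "real^'d" where "center = M *v (\<chi> i. 1 / 2)"

lemma kernel_factor_bounds: "0 \<le> kernel_factor i x" "kernel_factor i x \<le> 1"
  by (simp_all only: kernel_factor_def zero_le_power2 abs_square_le_1 abs_sin_le_one)

lemma kernel_bounds: "0 \<le> kernel x" "kernel x \<le> 1"
  unfolding kernel_def by (auto intro!: prod_nonneg prod_le_1 kernel_factor_bounds)

lemma kernel_center: "kernel center = 1"
  by (simp add: kernel_def kernel_factor_def center_def)

lemma continuous_on_kernel: "continuous_on A kernel"
  unfolding kernel_def[abs_def] kernel_factor_def by (intro continuous_intros)

text \<open>A product of factors in [0,1] equals 1 only if every factor does, and sin^2(pi t) = 1
  with t in [0,1] forces t = 1/2. The closed cell is used because the maximum in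
  \<open>kernel_peak\<close> is taken over a compact set.\<close>

lemma kernel_eq_1_imp:
  assumes "x \<in> (*v) M ` cbox 0 1" "kernel x = 1"
  shows "x = center"
proof -
  have "coords x $ i = 1 / 2" for i
  proof -
    have c: "0 \<le> coords x $ i" "coords x $ i \<le> 1"
      using assms(1) by (auto simp: mem_box_cart)
    have "kernel x = kernel_factor i x * (\<Prod>j\<in>UNIV - {i}. kernel_factor j x)"
      unfolding kernel_def by (rule prod.remove) auto
    also have "\<dots> \<le> kernel_factor i x * 1"
      by (intro mult_left_mono prod_le_1) (auto intro: kernel_factor_bounds)
    finally have "kernel_factor i x = 1" using assms(2) kernel_factor_bounds(2)[of i x] by linarith
    then have "cos (pi * coords x $ i) = cos (pi / 2)"
      using sin_cos_squared_add[of "pi * coords x $ i"] by (simp add: kernel_factor_def)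
    moreover have "0 \<le> pi * coords x $ i" "pi * coords x $ i \<le> pi"
      using c mult_left_mono[OF c(2), of pi] by simp_all
    ultimately have "pi * coords x $ i = pi / 2"
      using cos_inj_pi[of "pi * coords x $ i" "pi / 2"] pi_ge_zero by linarith
    then show ?thesis by simp
  qed
  then have "coords x = (\<chi> i. 1 / 2)" by (simp add: vec_eq_iff)
  then show ?thesis unfolding center_def by (metis M_coords)
qed

lemma center_ball:
  obtains \<epsilon> where "\<epsilon> > 0" "ball center \<epsilon> \<subseteq> D"
proof -
  have "open (\<Inter>i\<in>UNIV. {x. 0 < coords x $ i} \<inter> {x. coords x $ i < 1})"
    by (intro open_INT ballI open_Int open_Collect_less continuous_intros) auto
  moreover have "center \<in> (\<Inter>i\<in>UNIV. {x. 0 < coords x $ i} \<inter> {x. coords x $ i < 1})"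
    by (simp add: center_def)
  ultimately obtain \<epsilon> where "\<epsilon> > 0" "ball center \<epsilon> \<subseteq> (\<Inter>i\<in>UNIV. {x. 0 < coords x $ i} \<inter> {x. coords x $ i < 1})"
    by (rule openE)
  then show ?thesis by (intro that[of \<epsilon>]) (auto simp: mem_D less_imp_le)
qed

text \<open>Off the ball the kernel attains its maximum over a compact set, and this maximum is not
  1 because 1 occurs only at \<open>center\<close>. The gap between \<open>r\<close> and 1 is what
  later separates two geometric rates.\<close>

lemma kernel_peak:
  assumes "\<epsilon> > 0"
  obtains r where "0 \<le> r" "r < 1" "\<And>x. x \<in> D - ball center \<epsilon> \<Longrightarrow> kernel x \<le> r"
proof (cases "(*v) M ` cbox 0 1 - ball center \<epsilon> = {}")
  case True
  then show ?thesis using that[of 0] D_sub_compact by fastforce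
next
  case False
  have "compact ((*v) M ` cbox 0 1 - ball center \<epsilon>)"
    using compact_M_cbox by (simp add: compact_diff)
  then obtain y where y: "y \<in> (*v) M ` cbox 0 1 - ball center \<epsilon>"
    "\<And>x. x \<in> (*v) M ` cbox 0 1 - ball center \<epsilon> \<Longrightarrow> kernel x \<le> kernel y"
    using continuous_attains_sup[OF _ False continuous_on_kernel] by blast
  have "kernel y \<noteq> 1" using kernel_eq_1_imp[of y] y(1) assms by auto
  then have "kernel y < 1" using kernel_bounds(2)[of y] by linarith
  then show ?thesis using that[of "kernel y"] kernel_bounds(1) y(2) D_sub_compact by blast
qed

text \<open>If the value were nonzero, the powers \<open>kernel x ^ k\<close> would give a
  contribution of order at least \<open>s ^ k\<close> near the center, while the part of the cell
  away from it contributes at most of order \<open>r ^ k\<close> with \<open>r < s\<close>. For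
  large \<open>k\<close> the integral could not vanish.\<close>

lemma annihilated_zero_center:
  assumes \<psi>: "annihilated \<psi>"
  shows "\<psi> center = 0"
proof (rule ccontr)
  assume nz: "\<psi> center \<noteq> 0"
  \<comment> \<open>Multiplying by the conjugate rotates the value at the center onto the positive
    real axis, so only real parts have to be estimated.\<close>
  define z where "z = cnj (\<psi> center)"
  define u where "u x = Re (z * \<psi> x)" for x
  define m where "m = u center / 2"
  have cont: "continuous_on UNIV \<psi>" and per: "periodic \<psi>" using \<psi> by (auto simp: annihilated_def)
  have ucont: "continuous_on UNIV u" unfolding u_def by (intro continuous_intros cont)
  have "u center = (norm (\<psi> center))\<^sup>2"
    using cmod_power2[of "\<psi> center"] by (simp add: u_def z_def power2_eq_square)
  then have m: "m > 0" using nz by (simp add: m_def)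
  obtain B where B: "\<And>x. norm (\<psi> x) \<le> B" using periodic_continuous_bounded[OF per cont] by blast
  define K where "K = norm z * B"
  have uK: "\<bar>u x\<bar> \<le> K" for x
    using abs_Re_le_cmod[of "z * \<psi> x"] mult_left_mono[OF B[of x], of "norm z"]
    by (simp add: u_def K_def norm_mult)
  then have "K \<ge> 0" using abs_ge_zero order_trans by blast
  obtain \<epsilon>0 where e0: "\<epsilon>0 > 0" "ball center \<epsilon>0 \<subseteq> D" by (rule center_ball)
  have "open {x. m < u x}" by (intro open_Collect_less continuous_intros ucont)
  moreover have "center \<in> {x. m < u x}" using m by (simp add: m_def)
  ultimately obtain \<epsilon>1 where e1: "\<epsilon>1 > 0" "ball center \<epsilon>1 \<subseteq> {x. m < u x}"
    by (auto simp: open_contains_ball)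
  obtain r where r: "0 \<le> r" "r < 1" "\<And>x. x \<in> D - ball center \<epsilon>1 \<Longrightarrow> kernel x \<le> r"
    using kernel_peak[OF e1(1)] by metis
  \<comment> \<open>Any number strictly between \<open>r\<close> and 1 would do: near the center the
    kernel exceeds it by continuity.\<close>
  define s where "s = (1 + r) / 2"
  have s: "r < s" "s < 1" "0 < s" using r by (auto simp: s_def)
  have "open {x. s < kernel x}" by (intro open_Collect_less continuous_intros continuous_on_kernel)
  moreover have "center \<in> {x. s < kernel x}" using s by (simp add: kernel_center)
  ultimately obtain \<epsilon>2 where e2: "\<epsilon>2 > 0" "ball center \<epsilon>2 \<subseteq> {x. s < kernel x}"
    by (auto simp: open_contains_ball)
  \<comment> \<open>\<open>\<epsilon>0\<close> keeps the ball in the cell,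
    \<open>\<epsilon>1\<close> gives \<open>u > m\<close> and \<open>\<epsilon>2\<close> gives
    \<open>kernel > s\<close>. The last radius depends on \<open>s\<close>, hence on
    \<open>r\<close>, hence on \<open>\<epsilon>1\<close>.\<close>
  define \<epsilon> where "\<epsilon> = min \<epsilon>0 (min \<epsilon>1 \<epsilon>2)"
  define U where "U = ball center \<epsilon>"
  have U: "U \<subseteq> D" "\<And>x. x \<in> U \<Longrightarrow> m < u x" "\<And>x. x \<in> U \<Longrightarrow> s < kernel x"
    using e0 e1 e2 by (auto simp: U_def \<epsilon>_def)
  have [measurable]: "U \<in> sets borel" by (simp add: U_def)
  have "\<epsilon> > 0" using e0 e1 e2 by (simp add: \<epsilon>_def)
  define v where "v = measure lborel U"
  have "v > 0" using content_ball_pos[OF \<open>\<epsilon> > 0\<close>] by (simp add: v_def U_def)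
  have fin: "emeasure lborel U < \<infinity>" unfolding U_def by (rule emeasure_bounded_finite) simp
  have ineq: "m * s ^ k * v \<le> K * r ^ k * vol" for k
  proof -
    define G where "G x = indicator D x *\<^sub>R (\<psi> x * complex_of_real (kernel x ^ k))" for x
    have ann: "annihilated (\<lambda>x. \<psi> x * complex_of_real (kernel x ^ k))"
      by (rule annihilated_kernel_power[OF \<psi>])
    have G0: "(LINT x|lborel. G x) = 0"
      using ann dual_closed(1) by (force simp: annihilated_def G_def set_lebesgue_integral_def)
    have intG: "integrable lborel G"
      using annihilated_integrable[OF ann dual_closed(1)]
      by (simp add: set_integrable_def G_def[abs_def])
    have bl: "bounded_linear (\<lambda>w. Re (z * w))"
      by (intro bounded_linear_compose[OF bounded_linear_Re] bounded_linear_mult_right)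
    \<comment> \<open>Within the cell the integrand is at least \<open>m * s ^ k\<close> on
      \<open>U\<close>, nonnegative on the rest of the ball of radius \<open>\<epsilon>1\<close>,
      and at least \<open>- K * r ^ k\<close> elsewhere. The step function on the left lies below it
      in all three regions.\<close>
    have "(LINT x|lborel. m * s ^ k * indicator U x - K * r ^ k * indicator D x)
        \<le> (LINT x|lborel. Re (z * G x))"
    proof (rule integral_mono)
      show "integrable lborel (\<lambda>x. m * s ^ k * indicator U x - K * r ^ k * indicator D x)"
        using fin D_finite by (intro Bochner_Integration.integrable_diff integrable_mult_right integrable_real_indicator) auto
      show "integrable lborel (\<lambda>x. Re (z * G x))"
        by (rule integrable_bounded_linear[OF bl intG])
      fix x
      have ReG: "Re (z * G x) = indicator D x * (u x * kernel x ^ k)"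
        by (simp add: G_def u_def indicator_def field_simps)
      show "m * s ^ k * indicator U x - K * r ^ k * indicator D x \<le> Re (z * G x)"
        unfolding ReG
      proof (cases "x \<in> D")
        case False
        then show "m * s ^ k * indicator U x - K * r ^ k * indicator D x \<le> indicator D x * (u x * kernel x ^ k)"
          using U(1) by (auto simp: indicator_def)
      next
        case True
        have Kr: "0 \<le> K * r ^ k" using \<open>K \<ge> 0\<close> r(1) by simp
        consider "x \<in> U" | "x \<in> ball center \<epsilon>1" "x \<notin> U" | "x \<notin> ball center \<epsilon>1" by blast
        then show "m * s ^ k * indicator U x - K * r ^ k * indicator D x \<le> indicator D x * (u x * kernel x ^ k)"
        proof cases
          case 1
          have "m * s ^ k \<le> u x * kernel x ^ k"
            using U(2,3)[OF 1] m s by (intro mult_mono power_mono) auto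
          then show ?thesis using True 1 Kr by simp
        next
          case 2
          then have "0 \<le> u x" using e1(2) m by fastforce
          then have "0 \<le> u x * kernel x ^ k" using kernel_bounds(1) by simp
          then show ?thesis using True 2 Kr by simp
        next
          case 3
          have "kernel x ^ k \<le> r ^ k" using r(3)[of x] 3 True kernel_bounds(1) by (intro power_mono) auto
          then have "\<bar>u x * kernel x ^ k\<bar> \<le> K * r ^ k"
            unfolding abs_mult using uK kernel_bounds(1) \<open>K \<ge> 0\<close> by (intro mult_mono) auto
          moreover have "x \<notin> U" using 3 by (auto simp: U_def \<epsilon>_def)
          ultimately show ?thesis using True by simp
        qed
      qed
    qed
    also have "(LINT x|lborel. Re (z * G x)) = 0"
      using integral_bounded_linear[OF bl intG] G0 by simp
    also have "(LINT x|lborel. m * s ^ k * indicator U x - K * r ^ k * indicator D x) = m * s ^ k * v - K * r ^ k * vol"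
      using fin D_finite measure_D
      by (subst Bochner_Integration.integral_diff) (auto simp: v_def intro!: integrable_mult_right integrable_real_indicator)
    finally show ?thesis by simp
  qed
  have "(\<lambda>k. K * vol * (r / s) ^ k) \<longlonglongrightarrow> K * vol * 0"
    using s r by (intro tendsto_intros LIMSEQ_realpow_zero) auto
  moreover have "m * v \<le> K * vol * (r / s) ^ k" for k
  proof -
    have "m * v * s ^ k \<le> K * vol * r ^ k" using ineq[of k] by (simp add: mult_ac)
    then show ?thesis using s by (simp add: power_divide pos_le_divide_eq)
  qed
  ultimately have "m * v \<le> 0" by (auto intro: LIMSEQ_le_const)
  then show False using m \<open>v > 0\<close> by (simp add: mult_le_0_iff)
qed

text \<open>Translation multiplies each Fourier coefficient by a number of modulus 1, so the class
  is translation invariant and any point can be moved to \<open>center\<close>.\<close>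

theorem annihilated_zero:
  assumes \<psi>: "annihilated \<psi>"
  shows "\<psi> y = 0"
proof -
  let ?a = "y - center"
  have cont: "continuous_on UNIV \<psi>" and per: "periodic \<psi>" using \<psi> by (auto simp: annihilated_def)
  have "annihilated (\<lambda>x. \<psi> (x + ?a))"
    unfolding annihilated_def
  proof (intro conjI ballI)
    show "continuous_on UNIV (\<lambda>x. \<psi> (x + ?a))"
      by (rule continuous_on_compose2[OF cont]) (auto intro: continuous_intros)
    show "periodic (\<lambda>x. \<psi> (x + ?a))"
      unfolding periodic_def
    proof (intro allI ballI)
      fix x n assume "n \<in> L"
      then have "\<psi> ((x + ?a) + n) = \<psi> (x + ?a)" using per by (simp only: periodic_def)
      then show "\<psi> (x + n + ?a) = \<psi> (x + ?a)" by (simp only: add_ac)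
    qed
    fix \<xi> assume \<xi>: "\<xi> \<in> dual_lattice L"
    have c: "continuous_on UNIV (\<lambda>x. \<psi> x * character \<xi> x)" by (intro continuous_intros cont)
    have p: "periodic (\<lambda>x. \<psi> x * character \<xi> x)"
      by (intro periodic_mult per periodic_character \<xi>)
    obtain B where B: "\<And>x. norm (\<psi> x * character \<xi> x) \<le> B"
      using periodic_continuous_bounded[OF p c] by blast
    have "character \<xi> x = character \<xi> (- ?a) * character \<xi> (x + ?a)" for x
      using character_add_right[of \<xi> "- ?a" "x + ?a"] by simp
    then have eq: "\<psi> (x + ?a) * character \<xi> x = character \<xi> (- ?a) * (\<psi> (x + ?a) * character \<xi> (x + ?a))" for x
      by (metis mult.left_commute)
    have "(LINT x:D|lborel. \<psi> (x + ?a) * character \<xi> x) =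
        character \<xi> (- ?a) * (LINT x:D|lborel. \<psi> (x + ?a) * character \<xi> (x + ?a))"
      by (simp only: eq) simp
    also have "(LINT x:D|lborel. \<psi> (x + ?a) * character \<xi> (x + ?a)) = (LINT x:D|lborel. \<psi> x * character \<xi> x)"
      using periodic_integral_shift[OF p borel_measurable_continuous_onI[OF c] B] by simp
    also have "\<dots> = 0" using \<psi> \<xi> by (simp add: annihilated_def)
    finally show "(LINT x:D|lborel. \<psi> (x + ?a) * character \<xi> x) = 0" by simp
  qed
  from annihilated_zero_center[OF this] show ?thesis by simp
qed

end

subsection \<open>Poisson summation\<close>

definition lborel_fourier :: "(real^'d \<Rightarrow> complex) \<Rightarrow> real^'d \<Rightarrow> complex" where
  "lborel_fourier f \<xi> = (LINT x|lborel. f x * character (- \<xi>) x)"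

lemma borel_measurable_cnj [measurable]:
  "f \<in> borel_measurable M \<Longrightarrow> (\<lambda>x. cnj (f x)) \<in> borel_measurable M"
  by (rule borel_measurable_continuous_on[where f = cnj]) (intro continuous_intros)

text \<open>After Fubini the character splits as the product of its values at \<open>t\<close> and
  at \<open>x - t\<close>, and the inner integral is a translate of the one defining the transform
  of \<open>g\<close>.\<close>

lemma lborel_fourier_lborel_convolution:
  fixes f g :: "real^'d \<Rightarrow> complex"
  assumes f: "bounded_supported f" and g: "bounded_supported g"
  shows "lborel_fourier (lborel_convolution f g) \<xi> = lborel_fourier f \<xi> * lborel_fourier g \<xi>"
proof -
  obtain C R where CR: "C > 0" "R > 0" "\<And>x. norm (f x) \<le> C" "\<And>x. f x \<noteq> 0 \<Longrightarrow> norm x \<le> R"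
    using bounded_supportedD[OF f] by metis
  obtain B Q where BQ: "B > 0" "Q > 0" "\<And>x. norm (g x) \<le> B" "\<And>x. g x \<noteq> 0 \<Longrightarrow> norm x \<le> Q"
    using bounded_supportedD[OF g] by metis
  have [measurable]: "f \<in> borel_measurable borel" "g \<in> borel_measurable borel"
    using f g by (simp_all add: bounded_supported_def)
  let ?\<chi> = "character (- \<xi>)"
  define F where "F t x = f t * g (x - t) * ?\<chi> x" for t x
  \<comment> \<open>The integrand vanishes off this set, since \<open>x = t + (x - t)\<close>; being
    bounded by \<open>C * B\<close> on a set of finite measure, it is integrable.\<close>
  define E :: "((real^'d) \<times> (real^'d)) set" where "E = cball 0 R \<times> cball 0 (R + Q)"
  have E[measurable]: "E \<in> sets (lborel \<Otimes>\<^sub>M lborel)" by (simp add: E_def)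
  have "emeasure (lborel \<Otimes>\<^sub>M lborel) E < \<infinity>"
    using emeasure_lborel_cball_finite[of "0::real^'d"]
    by (simp add: E_def lborel.emeasure_pair_measure_Times ennreal_mult_less_top)
  then have intE: "integrable (lborel \<Otimes>\<^sub>M lborel) (\<lambda>p. C * B * indicator E p :: real)"
    by (intro integrable_mult_right integrable_real_indicator E)
  have intF: "integrable (lborel \<Otimes>\<^sub>M lborel) (case_prod F)"
  proof (rule Bochner_Integration.integrable_bound[OF intE])
    show "case_prod F \<in> borel_measurable (lborel \<Otimes>\<^sub>M lborel)"
      unfolding F_def by measurable
    have "norm (F t x) \<le> norm (C * B * indicator E (t, x) :: real)" for t x
    proof (cases "f t = 0 \<or> g (x - t) = 0")
      case False
      then have "norm t \<le> R" "norm (x - t) \<le> Q" using CR(4) BQ(4) by auto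
      then have "(t, x) \<in> E" using norm_triangle_ineq[of t "x - t"] by (auto simp: E_def)
      then show ?thesis using CR(1,3) BQ(1,3) by (auto simp: F_def norm_mult intro!: mult_mono)
    qed (auto simp: F_def)
    then show "AE p in lborel \<Otimes>\<^sub>M lborel. norm (case_prod F p) \<le> norm (C * B * indicator E p :: real)"
      by (auto intro!: AE_I2)
  qed
  have "lborel_fourier (lborel_convolution f g) \<xi> = (LINT x|lborel. LINT t|lborel. F t x)"
    by (simp add: lborel_fourier_def lborel_convolution_def F_def)
  also have "\<dots> = (LINT t|lborel. LINT x|lborel. F t x)"
    by (rule lborel_pair.Fubini_integral[OF intF])
  also have "\<dots> = (LINT t|lborel. f t * ?\<chi> t * lborel_fourier g \<xi>)"
  proof (rule Bochner_Integration.integral_cong[OF refl])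
    fix t
    have F: "F t x = f t * ?\<chi> t * (g (x - t) * ?\<chi> (x - t))" for x
      using character_add_right[of "- \<xi>" "x - t" t] by (simp add: F_def)
    have "(LINT x|lborel. g (x - t) * ?\<chi> (x - t)) = lborel_fourier g \<xi>"
      unfolding lborel_fourier_def using lborel_integral_translate[of "\<lambda>x. g x * ?\<chi> x" "- t"] by simp
    then show "(LINT x|lborel. F t x) = f t * ?\<chi> t * lborel_fourier g \<xi>"
      unfolding F by simp
  qed
  also have "\<dots> = lborel_fourier f \<xi> * lborel_fourier g \<xi>" by (simp add: lborel_fourier_def)
  finally show ?thesis .
qed

section \<open>Orthogonality of characters and Bessel's inequality\<close>

context lattice_with_basis
begin

text \<open>Orthogonality of characters. The pairing carries no conjugation, so
  \<open>character \<eta>\<close> picks out the coefficient at \<open>- \<eta>\<close>.\<close>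

lemma integral_trig_poly:
  fixes c :: "real^'d \<Rightarrow> complex"
  assumes S: "finite S" "S \<subseteq> dual_lattice L" and \<eta>: "\<eta> \<in> dual_lattice L"
  shows "(LINT x:D|lborel. (\<Sum>\<xi>\<in>S. c \<xi> * character \<xi> x) * character \<eta> x)
    = (if - \<eta> \<in> S then vol * c (- \<eta>) else 0)"
proof -
  have "(LINT x:D|lborel. (\<Sum>\<xi>\<in>S. c \<xi> * character \<xi> x) * character \<eta> x)
      = (LINT x|lborel. (\<Sum>\<xi>\<in>S. c \<xi> * (indicator D x *\<^sub>R character (\<xi> + \<eta>) x)))"
    unfolding set_lebesgue_integral_def
    by (simp add: sum_distrib_right scaleR_sum_right character_add mult.assoc)
  also have "\<dots> = (\<Sum>\<xi>\<in>S. c \<xi> * (LINT x:D|lborel. character (\<xi> + \<eta>) x))"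
    unfolding set_lebesgue_integral_def
  proof (subst Bochner_Integration.integral_sum)
    fix \<xi>
    have "set_integrable lborel D (character (\<xi> + \<eta>))"
      by (rule set_integrable_D[of _ 1]) auto
    then show "integrable lborel (\<lambda>x. c \<xi> * (indicator D x *\<^sub>R character (\<xi> + \<eta>) x))"
      unfolding set_integrable_def by (rule integrable_mult_right)
  qed (simp only: integral_mult_right_zero)
  also have "\<dots> = (\<Sum>\<xi>\<in>S. if \<xi> = - \<eta> then vol * c (- \<eta>) else 0)"
  proof (intro sum.cong refl)
    fix \<xi> assume "\<xi> \<in> S"
    then have "\<xi> + \<eta> \<in> dual_lattice L" using S \<eta> dual_closed by blast
    from integral_character[OF this] show "c \<xi> * (LINT x:D|lborel. character (\<xi> + \<eta>) x)
        = (if \<xi> = - \<eta> then vol * c (- \<eta>) else 0)"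
      by (auto simp flip: eq_neg_iff_add_eq_0)
  qed
  finally show ?thesis using S(1) by simp
qed

text \<open>With \<open>P = \<Sum>\<xi>\<in>S. f^(\<xi>) character \<xi>\<close>, the integral of \<open>f cnj P\<close> is \<open>s = \<Sum>\<xi>\<in>S. |f^(\<xi>)|^2\<close>, while that of \<open>|P|^2\<close>
  over finitely many cells covering the support of \<open>f\<close> is a multiple of \<open>s\<close>. Integrating
  \<open>0 \<le> |f - \<mu> P|^2\<close> for a suitable \<open>\<mu>\<close> bounds \<open>s\<close>.\<close>

lemma bessel:
  assumes f: "bounded_supported f"
  obtains K where "\<And>S. finite S \<Longrightarrow> S \<subseteq> dual_lattice L \<Longrightarrow> (\<Sum>\<xi>\<in>S. (norm (lborel_fourier f \<xi>))\<^sup>2) \<le> K"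
proof -
  obtain C R where CR: "C > 0" "R > 0" "\<And>x. norm (f x) \<le> C" "\<And>x. f x \<noteq> 0 \<Longrightarrow> norm x \<le> R"
    using bounded_supportedD[OF f] by metis
  have [measurable]: "f \<in> borel_measurable borel"
    using f by (simp add: bounded_supported_def)
  \<comment> \<open>The support of \<open>f\<close> may spread over several cells, and these are all
    that it can meet. Their number enters the final bound, which does not depend on
    \<open>S\<close>.\<close>
  define T where "T = cells (cball 0 R)"
  have T: "finite T" "T \<subseteq> L" by (auto simp: T_def finite_cells cells_subset)
  \<comment> \<open>The added 1 makes \<open>N\<close> positive without an argument that
    \<open>T\<close> is nonempty.\<close>
  define N where "N = real (card T) + 1"
  define F where "F = (LINT x|lborel. (norm (f x))\<^sup>2)"
  have "(\<Sum>\<xi>\<in>S. (norm (lborel_fourier f \<xi>))\<^sup>2) \<le> F * (N * vol)" if S: "finite S" "S \<subseteq> dual_lattice L" for S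
  proof -
    define c where "c = lborel_fourier f"
    define P where "P x = (\<Sum>\<xi>\<in>S. c \<xi> * character \<xi> x)" for x
    define s where "s = (\<Sum>\<xi>\<in>S. (norm (c \<xi>))\<^sup>2)"
    define w where "w x = indicator D x * (norm (P x))\<^sup>2" for x
    have [measurable]: "P \<in> borel_measurable borel" unfolding P_def by measurable
    have [measurable]: "w \<in> borel_measurable borel" unfolding w_def by measurable
    have Pper: "P (x + n) = P x" if "n \<in> L" for x n
      unfolding P_def using S(2) that by (intro sum.cong refl) (auto simp: character_periodic)
    define b where "b = (\<Sum>\<xi>\<in>S. norm (c \<xi>))"
    have Pb: "norm (P x) \<le> b" for x
      unfolding P_def b_def by (rule order_trans[OF norm_sum]) (simp add: norm_mult)
    have cP: "cnj (P x) = (\<Sum>\<eta>\<in>S. cnj (c \<eta>) * character (- \<eta>) x)" for x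
      by (simp add: P_def cnj_character)
    have sc: "(\<Sum>\<eta>\<in>S. cnj (c \<eta>) * c \<eta>) = complex_of_real s"
      unfolding s_def of_real_sum
      by (intro sum.cong refl) (metis complex_norm_square mult.commute of_real_power)
    have fP_int: "integrable lborel (\<lambda>x. f x * cnj (P x))"
      by (rule integrable_mult_bounded_supported[OF f, of _ b]) (auto simp: Pb)
    have fP: "(LINT x|lborel. f x * cnj (P x)) = complex_of_real s"
    proof -
      have "(LINT x|lborel. f x * cnj (P x)) = (LINT x|lborel. (\<Sum>\<eta>\<in>S. cnj (c \<eta>) * (f x * character (- \<eta>) x)))"
        by (simp add: cP sum_distrib_left mult.left_commute)
      also have "\<dots> = (\<Sum>\<eta>\<in>S. cnj (c \<eta>) * c \<eta>)"
        by (subst Bochner_Integration.integral_sum)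
          (auto simp: c_def lborel_fourier_def intro!: integrable_mult_right integrable_mult_bounded_supported[OF f, of _ 1])
      finally show ?thesis by (simp add: sc)
    qed
    have w_int: "integrable lborel w"
    proof -
      have "set_integrable lborel D (\<lambda>x. (norm (P x))\<^sup>2)"
        by (rule set_integrable_D[of _ "b\<^sup>2"]) (auto simp: Pb intro!: power_mono)
      then show ?thesis by (simp add: set_integrable_def w_def[abs_def])
    qed
    have w: "(LINT x|lborel. w x) = vol * s"
    proof -
      have Pc_int: "integrable lborel (\<lambda>x. cnj (c \<eta>) * (indicator D x *\<^sub>R (P x * character (- \<eta>) x)))" for \<eta>
      proof -
        have "set_integrable lborel D (\<lambda>x. P x * character (- \<eta>) x)"
          by (rule set_integrable_D[of _ b]) (auto simp: Pb norm_mult)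
        then show ?thesis unfolding set_integrable_def by (rule integrable_mult_right)
      qed
      have "complex_of_real (w x) = indicator D x *\<^sub>R (P x * cnj (P x))" for x
        using complex_norm_square[of "P x"] by (simp add: w_def scaleR_conv_of_real)
      then have "complex_of_real (LINT x|lborel. w x) = (LINT x|lborel. indicator D x *\<^sub>R (P x * cnj (P x)))"
        by (simp flip: integral_complex_of_real)
      also have "\<dots> = (LINT x|lborel. (\<Sum>\<eta>\<in>S. cnj (c \<eta>) * (indicator D x *\<^sub>R (P x * character (- \<eta>) x))))"
        by (simp add: cP sum_distrib_left scaleR_sum_right mult.left_commute)
      also have "\<dots> = (\<Sum>\<eta>\<in>S. cnj (c \<eta>) * (LINT x:D|lborel. P x * character (- \<eta>) x))"
        unfolding set_lebesgue_integral_def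
        by (subst Bochner_Integration.integral_sum, rule Pc_int) (simp only: integral_mult_right_zero)
      also have "\<dots> = (\<Sum>\<eta>\<in>S. vol * (cnj (c \<eta>) * c \<eta>))"
      proof (intro sum.cong refl)
        fix \<eta> assume "\<eta> \<in> S"
        then show "cnj (c \<eta>) * (LINT x:D|lborel. P x * character (- \<eta>) x) = vol * (cnj (c \<eta>) * c \<eta>)"
          unfolding P_def using S dual_closed(3) by (subst integral_trig_poly) auto
      qed
      also have "\<dots> = complex_of_real (vol * s)" by (simp add: sc flip: sum_distrib_left)
      finally show ?thesis using of_real_eq_iff by blast
    qed
    \<comment> \<open>This choice makes the quadratic term
      \<open>\<mu>\<^sup>2 * (N * (vol * s))\<close> equal to \<open>\<mu> * s\<close>, half of the
      linear term \<open>2 * \<mu> * s\<close>, so that \<open>\<mu> * s \<le> F\<close>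
      remains.\<close>
    define \<mu> where "\<mu> = 1 / (N * vol)"
    have N: "N \<ge> 1" by (simp add: N_def)
    have \<mu>: "\<mu> > 0" using N vol_pos by (simp add: \<mu>_def)
    have f2_int: "integrable lborel (\<lambda>x. (norm (f x))\<^sup>2)"
    proof -
      have "integrable lborel (\<lambda>x. f x * cnj (f x))"
        by (rule integrable_mult_bounded_supported[OF f, of _ C]) (auto simp: CR)
      then have "integrable lborel (\<lambda>x. complex_of_real ((norm (f x))\<^sup>2))"
        by (simp only: complex_norm_square)
      then show ?thesis by (simp only: complex_of_real_integrable_eq)
    qed
    have ws_int: "integrable lborel (\<lambda>x. \<Sum>n\<in>T. w (x + - n))"
      by (intro Bochner_Integration.integrable_sum lborel_integrable_translate w_int)
    \<comment> \<open>Where \<open>f x\<close> is nonzero, the translates of \<open>w\<close> add up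
      to \<open>(norm (P x))\<^sup>2\<close> and the claim follows from
      \<open>(norm (f x) - \<mu> * norm (P x))\<^sup>2 \<ge> 0\<close>. Elsewhere the left side is
      zero and the right side nonnegative.\<close>
    have pointwise: "2 * \<mu> * Re (f x * cnj (P x)) \<le> (norm (f x))\<^sup>2 + \<mu>\<^sup>2 * (\<Sum>n\<in>T. w (x + - n))" for x
    proof (cases "f x = 0")
      case True
      then show ?thesis by (auto simp: w_def intro!: mult_nonneg_nonneg sum_nonneg)
    next
      case False
      have "(\<Sum>n\<in>T. w (x + - n)) = (\<Sum>n\<in>T. indicator D (x - n) * (norm (P x))\<^sup>2)"
      proof (intro sum.cong refl)
        fix n assume "n \<in> T"
        then show "w (x + - n) = indicator D (x - n) * (norm (P x))\<^sup>2"
          using Pper[of "- n" x] T(2) L_closed(4) by (auto simp: w_def)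
      qed
      also have "\<dots> = (\<Sum>n\<in>T. indicator D (x - n)) * (norm (P x))\<^sup>2"
        by (rule sum_distrib_right[symmetric])
      also have "(\<Sum>n\<in>T. indicator D (x - n)) = (1::real)"
        using CR(4)[OF False] by (intro sum_indicator_cells T) (auto simp: T_def cells_def)
      finally have ws: "(\<Sum>n\<in>T. w (x + - n)) = (norm (P x))\<^sup>2" by simp
      have "Re (f x * cnj (P x)) \<le> norm (f x) * norm (P x)"
        using complex_Re_le_cmod[of "f x * cnj (P x)"] by (simp add: norm_mult)
      then have "2 * \<mu> * Re (f x * cnj (P x)) \<le> 2 * \<mu> * (norm (f x) * norm (P x))"
        using \<mu> by (intro mult_left_mono) auto
      also have "\<dots> \<le> (norm (f x))\<^sup>2 + \<mu>\<^sup>2 * (norm (P x))\<^sup>2"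
        using zero_le_power2[of "norm (f x) - \<mu> * norm (P x)"]
        by (simp add: power2_diff power_mult_distrib mult_ac)
      finally show ?thesis unfolding ws .
    qed
    have "2 * \<mu> * s = (LINT x|lborel. 2 * \<mu> * Re (f x * cnj (P x)))"
      using integral_Re[OF fP_int] fP by simp
    also have "\<dots> \<le> (LINT x|lborel. (norm (f x))\<^sup>2 + \<mu>\<^sup>2 * (\<Sum>n\<in>T. w (x + - n)))"
      by (intro integral_mono Bochner_Integration.integrable_add integrable_mult_right f2_int ws_int pointwise
        integrable_Re fP_int)
    also have "\<dots> = F + \<mu>\<^sup>2 * (\<Sum>n\<in>T. LINT x|lborel. w (x + - n))"
      by (subst Bochner_Integration.integral_add, (intro integrable_mult_right f2_int ws_int)+,
        simp only: integral_mult_right_zero F_def, subst Bochner_Integration.integral_sum)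
       (intro lborel_integrable_translate w_int refl)+
    also have "(\<Sum>n\<in>T. LINT x|lborel. w (x + - n)) = real (card T) * (vol * s)"
      by (subst lborel_integral_translate) (simp_all add: w)
    finally have "2 * \<mu> * s \<le> F + \<mu>\<^sup>2 * (real (card T) * (vol * s))" .
    also have "\<dots> \<le> F + \<mu>\<^sup>2 * (N * (vol * s))"
      using vol_pos by (intro add_left_mono mult_left_mono mult_right_mono) (auto simp: N_def s_def intro!: sum_nonneg mult_nonneg_nonneg)
    also have "\<mu>\<^sup>2 * (N * (vol * s)) = \<mu> * s"
      using N vol_pos by (simp add: \<mu>_def power2_eq_square)
    finally have "\<mu> * s \<le> F" by simp
    then show ?thesis
      using N vol_pos by (simp add: \<mu>_def s_def c_def pos_divide_le_eq)
  qed
  then show ?thesis using that by blast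
qed

lemma summable_lborel_fourier_square:
  assumes "bounded_supported f"
  shows "(\<lambda>\<xi>. (norm (lborel_fourier f \<xi>))\<^sup>2) summable_on dual_lattice L"
proof -
  obtain K where K: "\<And>S. finite S \<Longrightarrow> S \<subseteq> dual_lattice L \<Longrightarrow> (\<Sum>\<xi>\<in>S. (norm (lborel_fourier f \<xi>))\<^sup>2) \<le> K"
    using bessel[OF assms] by blast
  then show ?thesis
    by (intro nonneg_bdd_above_summable_on bdd_aboveI[of _ K]) auto
qed

text \<open>The elementary bound ab \<le> a^2 + b^2 turns two square summable families into one
  absolutely summable product.\<close>

lemma abs_summable_lborel_fourier_mult:
  assumes "bounded_supported f" "bounded_supported g"
  shows "(\<lambda>\<xi>. norm (lborel_fourier f \<xi> * lborel_fourier g \<xi>)) summable_on dual_lattice L"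
proof (rule Infinite_Sum.abs_summable_on_comparison_test')
  show "(\<lambda>\<xi>. (norm (lborel_fourier f \<xi>))\<^sup>2 + (norm (lborel_fourier g \<xi>))\<^sup>2) summable_on dual_lattice L"
    by (intro summable_on_add summable_lborel_fourier_square assms)
  fix \<xi>
  show "norm (lborel_fourier f \<xi> * lborel_fourier g \<xi>) \<le> (norm (lborel_fourier f \<xi>))\<^sup>2 + (norm (lborel_fourier g \<xi>))\<^sup>2"
    using zero_le_power2[of "norm (lborel_fourier f \<xi>) - norm (lborel_fourier g \<xi>)"]
      mult_nonneg_nonneg[OF norm_ge_zero norm_ge_zero, of "lborel_fourier f \<xi>" "lborel_fourier g \<xi>"]
    unfolding norm_mult power2_diff mult.assoc by linarith
qed

section \<open>The periodization against its Fourier series\<close>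

lemma norm_integral_D_le:
  fixes q :: "real^'d \<Rightarrow> complex"
  assumes "\<And>x. norm (q x) \<le> e" "set_integrable lborel D q"
  shows "norm (LINT x:D|lborel. q x) \<le> e * vol"
proof -
  have "norm (LINT x:D|lborel. q x) \<le> (LINT x|lborel. norm (indicator D x *\<^sub>R q x))"
    unfolding set_lebesgue_integral_def by (rule integral_norm_bound)
  also have "\<dots> \<le> (LINT x|lborel. e * indicator D x)"
    using assms D_finite unfolding set_integrable_def
    by (intro integral_mono integrable_norm integrable_mult_right integrable_real_indicator) (auto simp: indicator_def)
  also have "\<dots> = e * vol" using measure_D by simp
  finally show ?thesis .
qed

theorem poisson_summation:
  assumes h: "bounded_supported h" "continuous_on UNIV h"
    and sm: "(\<lambda>\<xi>. norm (lborel_fourier h \<xi>)) summable_on dual_lattice L"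
  shows "(\<lambda>n. h (n + x)) summable_on L"
    and "(\<lambda>\<xi>. lborel_fourier h \<xi> * character \<xi> x) summable_on dual_lattice L"
    and "(\<Sum>\<^sub>\<infinity>n\<in>L. h (n + x)) = 1 / complex_of_real vol * (\<Sum>\<^sub>\<infinity>\<xi>\<in>dual_lattice L. lborel_fourier h \<xi> * character \<xi> x)"
proof -
  obtain C R where CR: "C > 0" "R > 0" "\<And>x. norm (h x) \<le> C" "\<And>x. h x \<noteq> 0 \<Longrightarrow> norm x \<le> R"
    using bounded_supportedD[OF h(1)] by metis
  \<comment> \<open>If \<open>norm x \<le> K\<close>, then \<open>h (n + x)\<close> can be nonzero
    only for \<open>norm n \<le> K + R\<close>. On each ball the periodization is therefore one
    fixed finite sum, which gives its continuity.\<close>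
  define S where "S K = {n\<in>L. n \<in> cball 0 (K + R)}" for K
  have S: "finite (S K)" "S K \<subseteq> L" for K
    unfolding S_def by (intro finite_L_bounded bounded_cball) auto
  have fin: "((\<lambda>n. h (n + x)) has_sum (\<Sum>n\<in>S K. h (n + x))) L" if "norm x \<le> K" for x K
  proof (rule has_sum_finite_neutralI[OF S])
    fix n assume "n \<in> L - S K"
    then have "K + R < norm n" by (auto simp: S_def)
    then have "R < norm (n + x)" using that norm_diff_ineq[of n x] by simp
    then show "h (n + x) = 0" using CR(4) by fastforce
  qed simp
  from fin[OF order_refl] show "(\<lambda>n. h (n + x)) summable_on L" by (rule has_sum_imp_summable)
  define \<Phi> where "\<Phi> y = (\<Sum>\<^sub>\<infinity>n\<in>L. h (n + y))" for y
  have \<Phi>: "\<Phi> y = (\<Sum>n\<in>S K. h (n + y))" if "norm y \<le> K" for y K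
    unfolding \<Phi>_def using fin[OF that] by (rule infsumI)
  have \<Phi>_cont: "continuous_on UNIV \<Phi>"
  proof -
    have "continuous_on (ball 0 K) \<Phi>" for K
    proof -
      have "continuous_on (ball 0 K) (\<lambda>y. \<Sum>n\<in>S K. h (n + y))"
        by (intro continuous_on_sum continuous_on_compose2[OF h(2)] continuous_intros) auto
      then show ?thesis by (rule continuous_on_eq) (rule \<Phi>[symmetric], simp)
    qed
    then have "isCont \<Phi> y" for y
      using continuous_on_eq_continuous_at[of "ball 0 (norm y + 1)" \<Phi>] by simp
    then show ?thesis by (simp add: continuous_at_imp_continuous_on)
  qed
  have \<Phi>_per: "periodic \<Phi>"
    unfolding periodic_def
  proof (intro allI ballI)
    fix y n assume n: "n \<in> L"
    have "bij_betw (\<lambda>m. m + n) L L"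
      by (rule bij_betwI[of _ _ _ "\<lambda>m. m - n"]) (use n L_closed in auto)
    from infsum_reindex_bij_betw[OF this, of "\<lambda>m. h (m + y)"]
    show "\<Phi> (y + n) = \<Phi> y" by (simp add: \<Phi>_def add_ac)
  qed
  \<comment> \<open>Unfolding: the characters of the dual lattice are periodic, so the sum over the
    cells turns the integral over \<open>D\<close> into one over the whole space.\<close>
  have \<Phi>_coeff: "(LINT y:D|lborel. \<Phi> y * character \<xi> y) = lborel_fourier h (- \<xi>)"
    if \<xi>: "\<xi> \<in> dual_lattice L" for \<xi>
  proof -
    obtain K where K: "\<And>y. y \<in> D \<Longrightarrow> norm y \<le> K" using bounded_D by (auto simp: bounded_iff)
    have int: "integrable lborel (\<lambda>y. h y * character \<xi> y)"
      by (rule integrable_mult_bounded_supported[OF h(1), of _ 1]) auto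
    have "lborel_fourier h (- \<xi>) = (LINT y|lborel. h y * character \<xi> y)" by (simp add: lborel_fourier_def)
    also have "\<dots> = (\<Sum>n\<in>S K. LINT y:D|lborel. h (y + n) * character \<xi> (y + n))"
    proof (rule integral_eq_sum_cells[OF int S])
      fix y n assume y: "h y * character \<xi> y \<noteq> 0" "n \<in> L" "y - n \<in> D"
      have "norm n \<le> norm y + norm (y - n)" using norm_triangle_ineq4[of y "y - n"] by simp
      also have "\<dots> \<le> K + R" using CR(4)[of y] K[OF y(3)] y(1) by auto
      finally show "n \<in> S K" using y(2) by (simp add: S_def)
    qed
    also have "\<dots> = (LINT y:D|lborel. \<Sum>n\<in>S K. h (y + n) * character \<xi> (y + n))"
      unfolding set_lebesgue_integral_def scaleR_sum_right
      by (intro Bochner_Integration.integral_sum[symmetric]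
        integrable_mult_indicator lborel_integrable_translate[OF int]) simp
    also have "\<dots> = (LINT y:D|lborel. \<Phi> y * character \<xi> y)"
    proof (rule set_lebesgue_integral_cong)
      show "\<forall>y. y \<in> D \<longrightarrow> (\<Sum>n\<in>S K. h (y + n) * character \<xi> (y + n)) = \<Phi> y * character \<xi> y"
        using S(2)[of K] by (auto simp: \<Phi>[OF K] sum_distrib_right character_periodic[OF \<xi>] add.commute intro!: sum.cong)
    qed simp
    finally show ?thesis by simp
  qed
  define a where "a = lborel_fourier h"
  define \<Sigma> where "\<Sigma> y = (\<Sum>\<^sub>\<infinity>\<xi>\<in>dual_lattice L. a \<xi> * character \<xi> y)" for y
  let ?F = "finite_subsets_at_top (dual_lattice L)"
  show "(\<lambda>\<xi>. lborel_fourier h \<xi> * character \<xi> x) summable_on dual_lattice L"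
    by (rule abs_summable_summable) (use sm in \<open>simp add: norm_mult\<close>)
  have unif: "uniform_limit UNIV (\<lambda>X y. \<Sum>\<xi>\<in>X. a \<xi> * character \<xi> y) \<Sigma> ?F"
    unfolding \<Sigma>_def[abs_def]
    by (rule Weierstrass_m_test_general[of _ _ _ "\<lambda>\<xi>. norm (a \<xi>)"]) (use sm in \<open>auto simp: norm_mult a_def\<close>)
  have \<Sigma>_cont: "continuous_on UNIV \<Sigma>"
    by (rule uniform_limit_theorem[OF _ unif]) (auto intro!: always_eventually continuous_intros)
  have \<Sigma>_per: "periodic \<Sigma>"
    unfolding periodic_def \<Sigma>_def by (auto simp: character_periodic intro!: infsum_cong)
  have \<Sigma>_coeff: "(LINT y:D|lborel. \<Sigma> y * character \<xi> y) = vol * a (- \<xi>)"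
    if \<xi>: "\<xi> \<in> dual_lattice L" for \<xi>
  proof -
    define I where "I X = (LINT y:D|lborel. (\<Sum>\<eta>\<in>X. a \<eta> * character \<eta> y) * character \<xi> y)" for X
    define J where "J = (LINT y:D|lborel. \<Sigma> y * character \<xi> y)"
    have ev: "eventually (\<lambda>X. finite X \<and> X \<subseteq> dual_lattice L) ?F"
      by (rule eventually_finite_subsets_at_top_weakI) auto
    have "(I \<longlongrightarrow> J) ?F"
    proof (rule tendstoI)
      fix e :: real assume e: "e > 0"
      \<comment> \<open>Integration over \<open>D\<close> costs a factor \<open>vol\<close>; the 2
        makes the final inequality strict.\<close>
      have "e / (2 * vol) > 0" using e vol_pos by simp
      from uniform_limitD[OF unif this] ev
      show "\<forall>\<^sub>F X in ?F. dist (I X) J < e"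
      proof eventually_elim
        case (elim X)
        have i1: "set_integrable lborel D (\<lambda>y. (\<Sum>\<eta>\<in>X. a \<eta> * character \<eta> y) * character \<xi> y)"
          using elim \<xi> by (intro periodic_continuous_set_integrable continuous_intros periodic_mult periodic_character)
            (auto simp: periodic_def character_periodic intro!: sum.cong)
        have i2: "set_integrable lborel D (\<lambda>y. \<Sigma> y * character \<xi> y)"
          using \<xi> by (intro periodic_continuous_set_integrable continuous_intros periodic_mult periodic_character \<Sigma>_cont \<Sigma>_per)
        have "I X - J = (LINT y:D|lborel. (\<Sum>\<eta>\<in>X. a \<eta> * character \<eta> y) * character \<xi> y - \<Sigma> y * character \<xi> y)"
          unfolding I_def J_def using i1 i2 by (simp add: set_integral_diff)
        also have "norm \<dots> \<le> e / (2 * vol) * vol"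
        proof (rule norm_integral_D_le)
          fix y
          show "norm ((\<Sum>\<eta>\<in>X. a \<eta> * character \<eta> y) * character \<xi> y - \<Sigma> y * character \<xi> y) \<le> e / (2 * vol)"
            using elim(1) by (simp add: dist_norm norm_mult less_imp_le flip: left_diff_distrib)
        qed (intro set_integral_diff i1 i2)
        also have "\<dots> < e" using e vol_pos by simp
        finally show ?case by (simp add: dist_norm)
      qed
    qed
    moreover have "(I \<longlongrightarrow> vol * a (- \<xi>)) ?F"
    proof (rule tendsto_eventually)
      \<comment> \<open>By orthogonality \<open>I X\<close> no longer changes once the finite set
        \<open>X\<close> contains \<open>- \<xi>\<close>.\<close>
      have "eventually (\<lambda>X. {- \<xi>} \<subseteq> X \<and> finite X \<and> X \<subseteq> dual_lattice L) ?F"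
        unfolding eventually_finite_subsets_at_top using dual_closed(3)[OF \<xi>]
        by (intro exI[of _ "{- \<xi>}"]) auto
      then show "\<forall>\<^sub>F X in ?F. I X = vol * a (- \<xi>)"
        by eventually_elim (simp add: I_def integral_trig_poly \<xi>)
    qed
    ultimately show ?thesis unfolding J_def[symmetric]
      by (intro tendsto_unique[of ?F]) (auto simp: finite_subsets_at_top_neq_bot)
  qed
  \<comment> \<open>The factor \<open>vol\<close> balances the coefficients: the integral of
    \<open>\<Phi> y * character \<xi> y\<close> over \<open>D\<close> is \<open>a (- \<xi>)\<close>,
    that of \<open>\<Sigma> y * character \<xi> y\<close> is
    \<open>vol * a (- \<xi>)\<close>.\<close>
  define \<psi> where "\<psi> y = vol * \<Phi> y - \<Sigma> y" for y
  have "annihilated \<psi>"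
    unfolding annihilated_def
  proof (intro conjI ballI)
    show "continuous_on UNIV \<psi>" unfolding \<psi>_def by (intro continuous_intros \<Phi>_cont \<Sigma>_cont)
    show "periodic \<psi>" using \<Phi>_per \<Sigma>_per by (simp add: periodic_def \<psi>_def)
    fix \<xi> assume \<xi>: "\<xi> \<in> dual_lattice L"
    have i1: "set_integrable lborel D (\<lambda>y. \<Phi> y * character \<xi> y)"
      using \<xi> by (intro periodic_continuous_set_integrable continuous_intros periodic_mult periodic_character \<Phi>_cont \<Phi>_per)
    have i2: "set_integrable lborel D (\<lambda>y. \<Sigma> y * character \<xi> y)"
      using \<xi> by (intro periodic_continuous_set_integrable continuous_intros periodic_mult periodic_character \<Sigma>_cont \<Sigma>_per)
    have "(LINT y:D|lborel. \<psi> y * character \<xi> y) =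
        (LINT y:D|lborel. vol * (\<Phi> y * character \<xi> y) - \<Sigma> y * character \<xi> y)"
      by (simp add: \<psi>_def left_diff_distrib mult.assoc)
    also have "\<dots> = vol * (LINT y:D|lborel. \<Phi> y * character \<xi> y) - (LINT y:D|lborel. \<Sigma> y * character \<xi> y)"
      using i1 i2 by (subst set_integral_diff) auto
    also have "\<dots> = 0" by (simp add: \<Phi>_coeff[OF \<xi>] \<Sigma>_coeff[OF \<xi>] a_def)
    finally show "(LINT y:D|lborel. \<psi> y * character \<xi> y) = 0" .
  qed
  then have "\<psi> x = 0" by (rule annihilated_zero)
  then show "(\<Sum>\<^sub>\<infinity>n\<in>L. h (n + x)) = 1 / complex_of_real vol * (\<Sum>\<^sub>\<infinity>\<xi>\<in>dual_lattice L. lborel_fourier h \<xi> * character \<xi> x)"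
    using vol_pos by (simp add: \<psi>_def \<Phi>_def \<Sigma>_def a_def field_simps)
qed

end

subsection \<open>Lebesgue measurable functions\<close>

lemma completion_ex_borel_measurable_complex:
  fixes f :: "'a \<Rightarrow> complex"
  assumes "f \<in> borel_measurable (completion M)"
  obtains g where "g \<in> borel_measurable M" "AE x in M. f x = g x"
proof -
  have "(\<lambda>x. Re (f x)) \<in> borel_measurable (completion M)" "(\<lambda>x. Im (f x)) \<in> borel_measurable (completion M)"
    using assms by simp_all
  then obtain p q where pq: "p \<in> borel_measurable M" "AE x in M. Re (f x) = p x"
      "q \<in> borel_measurable M" "AE x in M. Im (f x) = q x"
    by (metis completion_ex_borel_measurable_real)
  show ?thesis
  proof
    show "(\<lambda>x. Complex (p x) (q x)) \<in> borel_measurable M"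
      unfolding Complex_eq using pq by (auto intro!: borel_measurable_add borel_measurable_times borel_measurable_of_real)
    show "AE x in M. f x = Complex (p x) (q x)"
      using pq(2,4) by eventually_elim (simp add: complex_eq_iff)
  qed
qed

text \<open>A Borel version of \<open>f\<close> may be unbounded or spread out on the exceptional
  null set. Cutting it off at the bounds of \<open>f\<close> and of \<open>A\<close> repairs this
  and leaves it equal to \<open>f\<close> almost everywhere.\<close>

lemma ex_bounded_supported:
  fixes f :: "real^'d \<Rightarrow> complex"
  assumes f: "f \<in> borel_measurable lebesgue" and bd: "bounded (range f)" "bounded A" "\<And>x. x \<notin> A \<Longrightarrow> f x = 0"
  obtains g where "bounded_supported g" "AE x in lborel. f x = g x"
proof -
  obtain p where p: "p \<in> borel_measurable lborel" "AE x in lborel. f x = p x"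
    by (rule completion_ex_borel_measurable_complex[OF f])
  have [measurable]: "p \<in> borel_measurable borel" using p(1) by simp
  obtain C where C: "\<And>x. norm (f x) \<le> C" using bd(1) by (auto simp: bounded_iff)
  obtain R where R: "\<And>x. x \<in> A \<Longrightarrow> norm x \<le> R" using bd(2) by (auto simp: bounded_iff)
  have C0: "C \<ge> 0" using C norm_ge_zero order_trans by blast
  define g where "g x = (if norm x \<le> R \<and> norm (p x) \<le> C then p x else 0)" for x
  show ?thesis
  proof
    have [measurable]: "g \<in> borel_measurable borel" unfolding g_def[abs_def] by measurable
    have "bounded (range g)" unfolding bounded_iff by (rule exI[of _ C]) (auto simp: g_def C0)
    moreover have "bounded {x. g x \<noteq> 0}" unfolding bounded_iff by (rule exI[of _ R]) (auto simp: g_def)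
    ultimately show "bounded_supported g" by (simp add: bounded_supported_def)
    show "AE x in lborel. f x = g x"
      using p(2)
    proof eventually_elim
      case (elim x)
      then show ?case using C[of x] R[of x] bd(3)[of x] by (cases "x \<in> A") (auto simp: g_def)
    qed
  qed
qed

text \<open>Completeness of \<open>lebesgue\<close> makes \<open>f\<close> measurable, since it
  agrees almost everywhere with a Borel function.\<close>

lemma lebesgue_integral_eq_lborel:
  fixes f g :: "real^'d \<Rightarrow> complex"
  assumes "AE x in lborel. f x = g x" "g \<in> borel_measurable borel"
  shows "(LINT x|lebesgue. f x) = (LINT x|lborel. g x)"
proof -
  have g: "g \<in> borel_measurable lebesgue" using assms(2) by (simp add: measurable_completion)
  have ae: "AE x in lebesgue. f x = g x" using assms(1) by (rule AE_completion)
  have "f \<in> borel_measurable lebesgue"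
    by (rule borel_measurable_AE[OF g]) (use ae in \<open>simp add: eq_commute\<close>)
  then have "(LINT x|lebesgue. f x) = (LINT x|lebesgue. g x)" using g ae by (rule integral_cong_AE)
  also have "\<dots> = (LINT x|lborel. g x)" using assms(2) by (simp add: integral_completion)
  finally show ?thesis .
qed

lemma fourier_eq_lborel_fourier:
  assumes "AE x in lborel. f x = g x" and [measurable]: "g \<in> borel_measurable borel"
  shows "fourier f \<xi> = lborel_fourier g \<xi>"
  unfolding fourier_def lborel_fourier_def character_eq_exp
  by (rule lebesgue_integral_eq_lborel) (use assms(1) in \<open>auto elim: eventually_mono\<close>)

text \<open>Equality holds at every point: for each fixed \<open>x\<close> the exceptional set of
  \<open>g\<close>, reflected to the variable \<open>t\<close>, is still null. Pointwise claims
  about \<open>f * g\<close> therefore survive the passage to Borel versions.\<close>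

lemma convolution_eq_lborel_convolution:
  assumes "AE x in lborel. f x = f0 x" and [measurable]: "f0 \<in> borel_measurable borel"
    and "AE x in lborel. g x = g0 x" and [measurable]: "g0 \<in> borel_measurable borel"
  shows "convolution f g = lborel_convolution f0 g0"
proof
  fix x
  show "convolution f g x = lborel_convolution f0 g0 x"
    unfolding convolution_def lborel_convolution_def
  proof (rule lebesgue_integral_eq_lborel)
    show "AE t in lborel. f t * g (x - t) = f0 t * g0 (x - t)"
      using assms(1) AE_lborel_reflect[OF assms(3), of x] by eventually_elim simp
  qed measurable
qed

text \<open>Reflection and conjugation each reverse the sign of the frequency, so together they only
  conjugate the transform. This is the source of the conjugate in the formula for
  intersections.\<close>

lemma fourier_cnj_reflect:
  fixes f :: "real^'d \<Rightarrow> complex"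
  assumes "f \<in> borel_measurable lebesgue"
  shows "fourier (\<lambda>x. cnj (f (- x))) \<xi> = cnj (fourier f \<xi>)"
proof -
  obtain g where g: "g \<in> borel_measurable lborel" "AE x in lborel. f x = g x"
    by (rule completion_ex_borel_measurable_complex[OF assms])
  have [measurable]: "g \<in> borel_measurable borel" using g(1) by simp
  have "AE x in lborel. cnj (f (- x)) = cnj (g (- x))"
    using AE_lborel_reflect[OF g(2), of 0] by eventually_elim simp
  then have "fourier (\<lambda>x. cnj (f (- x))) \<xi> = lborel_fourier (\<lambda>x. cnj (g (- x))) \<xi>"
    by (rule fourier_eq_lborel_fourier) measurable
  also have "\<dots> = (LINT x|lborel. cnj (g (0 - x)) * character \<xi> (0 - x))"
    by (simp add: lborel_fourier_def character_minus)
  also have "\<dots> = (LINT x|lborel. cnj (g x) * character \<xi> x)"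
    by (rule lborel_integral_reflect) measurable
  also have "\<dots> = cnj (lborel_fourier g \<xi>)"
    unfolding lborel_fourier_def by (subst Bochner_Integration.integral_cnj[symmetric]) (simp add: cnj_character del: Bochner_Integration.integral_cnj)
  also have "lborel_fourier g \<xi> = fourier f \<xi>"
    by (rule fourier_eq_lborel_fourier[symmetric, OF g(2)]) measurable
  finally show ?thesis .
qed

lemma convolution_poisson:
  fixes f g :: "real^'d \<Rightarrow> complex"
  assumes f: "f \<in> borel_measurable lebesgue" "bounded (range f)" "bounded A" "\<And>x. x \<notin> A \<Longrightarrow> f x = 0"
    and g: "g \<in> borel_measurable lebesgue" "bounded (range g)" "bounded B" "\<And>x. x \<notin> B \<Longrightarrow> g x = 0"
  shows "continuous_on UNIV (convolution f g)"
    and "poisson_summation_friendly (convolution f g)"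
    and "fourier (convolution f g) \<xi> = fourier f \<xi> * fourier g \<xi>"
proof -
  obtain f0 where f0: "bounded_supported f0" "AE x in lborel. f x = f0 x"
    by (rule ex_bounded_supported[OF f])
  obtain g0 where g0: "bounded_supported g0" "AE x in lborel. g x = g0 x"
    by (rule ex_bounded_supported[OF g])
  have [measurable]: "f0 \<in> borel_measurable borel" "g0 \<in> borel_measurable borel"
    using f0(1) g0(1) by (simp_all add: bounded_supported_def)
  have conv: "convolution f g = lborel_convolution f0 g0"
    by (rule convolution_eq_lborel_convolution) (auto simp: f0 g0)
  have h: "bounded_supported (lborel_convolution f0 g0)" by (rule bounded_supported_lborel_convolution[OF f0(1) g0(1)])
  have cont: "continuous_on UNIV (lborel_convolution f0 g0)" by (rule continuous_on_lborel_convolution[OF f0(1) g0(1)])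
  have [measurable]: "lborel_convolution f0 g0 \<in> borel_measurable borel" using h by (simp add: bounded_supported_def)
  have F: "fourier (lborel_convolution f0 g0) = lborel_fourier (lborel_convolution f0 g0)"
    by (intro ext fourier_eq_lborel_fourier) auto
  show "continuous_on UNIV (convolution f g)" unfolding conv by (rule cont)
  show "fourier (convolution f g) \<xi> = fourier f \<xi> * fourier g \<xi>"
    using fourier_eq_lborel_fourier[OF f0(2), of \<xi>] fourier_eq_lborel_fourier[OF g0(2), of \<xi>]
    by (simp add: conv F lborel_fourier_lborel_convolution[OF f0(1) g0(1)])
  show "poisson_summation_friendly (convolution f g)"
    unfolding poisson_summation_friendly_def conv F character_eq_exp
  proof (intro conjI allI impI)
    show "integrable lebesgue (lborel_convolution f0 g0)"
      using integrable_bounded_supported[OF h] by (simp add: integrable_completion)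
    fix L :: "(real^'d) set" and x
    assume "full_rank_lattice L"
    then obtain M where "lattice_basis M L" by (auto simp: full_rank_lattice_def)
    then interpret lattice_with_basis M L by unfold_locales
    have "(\<lambda>\<xi>. norm (lborel_fourier (lborel_convolution f0 g0) \<xi>)) summable_on dual_lattice L"
      unfolding lborel_fourier_lborel_convolution[OF f0(1) g0(1)] by (rule abs_summable_lborel_fourier_mult[OF f0(1) g0(1)])
    note P = poisson_summation[OF h cont this, of x]
    show "(\<lambda>n. lborel_convolution f0 g0 (n + x)) summable_on L"
      and "(\<lambda>m. lborel_fourier (lborel_convolution f0 g0) m * character m x) summable_on dual_lattice L"
      and "(\<Sum>\<^sub>\<infinity>n\<in>L. lborel_convolution f0 g0 (n + x)) =
         1 / complex_of_real (lattice_det L) * (\<Sum>\<^sub>\<infinity>m\<in>dual_lattice L. lborel_fourier (lborel_convolution f0 g0) m * character m x)"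
      by (fact P)+
  qed
qed

section \<open>Explicit formulas for convolutions and for intersections with translates\<close>

lemma convolution_poisson_formula:
  fixes f g :: "real^'d \<Rightarrow> complex"
  assumes f: "f \<in> borel_measurable lebesgue" "bounded (range f)" "bounded A" "\<And>x. x \<notin> A \<Longrightarrow> f x = 0"
    and g: "g \<in> borel_measurable lebesgue" "bounded (range g)" "bounded B" "\<And>x. x \<notin> B \<Longrightarrow> g x = 0"
    and L: "full_rank_lattice L"
  shows "(\<lambda>n. convolution f g (x + n)) summable_on L"
    and "(\<lambda>\<xi>. fourier f \<xi> * fourier g \<xi> * exp (2 * complex_of_real pi * \<i> * complex_of_real (\<xi> \<bullet> x)))
      summable_on dual_lattice L"
    and "(\<Sum>\<^sub>\<infinity>n\<in>L. convolution f g (x + n)) = 1 / complex_of_real (lattice_det L) *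
      (\<Sum>\<^sub>\<infinity>\<xi>\<in>dual_lattice L. fourier f \<xi> * fourier g \<xi> * exp (2 * complex_of_real pi * \<i> * complex_of_real (\<xi> \<bullet> x)))"
proof -
  have F: "fourier (convolution f g) = (\<lambda>\<xi>. fourier f \<xi> * fourier g \<xi>)"
    by (rule ext) (rule convolution_poisson(3)[OF f g])
  show "(\<lambda>n. convolution f g (x + n)) summable_on L"
    and "(\<lambda>\<xi>. fourier f \<xi> * fourier g \<xi> * exp (2 * complex_of_real pi * \<i> * complex_of_real (\<xi> \<bullet> x)))
      summable_on dual_lattice L"
    and "(\<Sum>\<^sub>\<infinity>n\<in>L. convolution f g (x + n)) = 1 / complex_of_real (lattice_det L) *
      (\<Sum>\<^sub>\<infinity>\<xi>\<in>dual_lattice L. fourier f \<xi> * fourier g \<xi> * exp (2 * complex_of_real pi * \<i> * complex_of_real (\<xi> \<bullet> x)))"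
    using convolution_poisson(2)[OF f g] L
    unfolding poisson_summation_friendly_def F by (simp_all add: add.commute[of x])
qed

lemma lebesgue_sets_reflect:
  fixes B :: "(real^'d) set"
  assumes "B \<in> sets lebesgue"
  shows "uminus ` B \<in> sets lebesgue"
proof -
  have "uminus ` B = (*\<^sub>R) (- 1) -` B \<inter> space lebesgue"
    by (force simp: image_iff)
  also have "\<dots> \<in> sets lebesgue"
    by (rule measurable_sets[OF lebesgue_measurable_scaling assms])
  finally show ?thesis .
qed

lemma convolution_indicator_reflect:
  fixes A B :: "(real^'d) set"
  assumes A: "A \<in> sets lebesgue" and B: "B \<in> sets lebesgue"
  shows "convolution (indicator A) (indicator (uminus ` B)) y = complex_of_real (measure lebesgue (A \<inter> (\<lambda>b. b + y) ` B))"
proof -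
  have "(\<lambda>b. b + y) ` B \<in> sets lebesgue"
    using lebesgue_sets_translation[OF B, of y] by (simp add: add.commute)
  then have m: "A \<inter> (\<lambda>b. b + y) ` B \<in> sets lebesgue" using A by blast
  have "y - t = - b \<longleftrightarrow> t = b + y" for t b
    by (auto simp: algebra_simps)
  then have "y - t \<in> uminus ` B \<longleftrightarrow> t \<in> (\<lambda>b. b + y) ` B" for t
    by (simp only: image_iff)
  then have "indicator A t * indicator (uminus ` B) (y - t)
      = complex_of_real (indicator (A \<inter> (\<lambda>b. b + y) ` B) t)" for t
    by (simp add: indicator_def)
  then show ?thesis unfolding convolution_def by simp
qed

theorem theorem1:
  fixes A B :: "(real^'d) set"
  assumes "bounded A" "A \<in> sets lebesgue"
    and "bounded B" "B \<in> sets lebesgue"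
  shows
    "(\<forall>f g :: real^'d \<Rightarrow> complex.
        in_L1_L2 f \<and> bounded (range f) \<and> (\<forall>x. x \<notin> A \<longrightarrow> f x = 0) \<and>
        in_L1_L2 g \<and> bounded (range g) \<and> (\<forall>x. x \<notin> B \<longrightarrow> g x = 0) \<longrightarrow>
          continuous_on UNIV (convolution f g) \<and>
          poisson_summation_friendly (convolution f g) \<and>
          (\<forall>L x. full_rank_lattice L \<longrightarrow>
             (\<lambda>n. convolution f g (x + n)) summable_on L \<and>
             (\<lambda>\<xi>. fourier f \<xi> * fourier g \<xi> *
                exp (2 * complex_of_real pi * \<i> * complex_of_real (\<xi> \<bullet> x)))
               summable_on dual_lattice L \<and>
             (\<Sum>\<^sub>\<infinity>n\<in>L. convolution f g (x + n)) =
               1 / complex_of_real (lattice_det L) *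
               (\<Sum>\<^sub>\<infinity>\<xi>\<in>dual_lattice L. fourier f \<xi> * fourier g \<xi> *
                  exp (2 * complex_of_real pi * \<i> * complex_of_real (\<xi> \<bullet> x))))) \<and>
     (\<forall>L x. full_rank_lattice L \<longrightarrow>
        (\<lambda>n. measure lebesgue (A \<inter> (\<lambda>b. b + x + n) ` B)) summable_on L \<and>
        (\<lambda>\<xi>. fourier (indicator A) \<xi> * cnj (fourier (indicator B) \<xi>) *
           exp (2 * complex_of_real pi * \<i> * complex_of_real (\<xi> \<bullet> x)))
          summable_on dual_lattice L \<and>
        complex_of_real (\<Sum>\<^sub>\<infinity>n\<in>L. measure lebesgue (A \<inter> (\<lambda>b. b + x + n) ` B)) =
          1 / complex_of_real (lattice_det L) *
          (\<Sum>\<^sub>\<infinity>\<xi>\<in>dual_lattice L. fourier (indicator A) \<xi> * cnj (fourier (indicator B) \<xi>) *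
             exp (2 * complex_of_real pi * \<i> * complex_of_real (\<xi> \<bullet> x))))"
proof ((rule conjI; intro allI impI), goal_cases)
  case (1 f g)
  then have f: "f \<in> borel_measurable lebesgue" "bounded (range f)" "\<And>x. x \<notin> A \<Longrightarrow> f x = 0"
    and g: "g \<in> borel_measurable lebesgue" "bounded (range g)" "\<And>x. x \<notin> B \<Longrightarrow> g x = 0"
    by (auto simp: in_L1_L2_def)
  note fg = f(1,2) assms(1) f(3) g(1,2) assms(3) g(3)
  show ?case
    using convolution_poisson[OF fg] convolution_poisson_formula[OF fg] by blast
next
  case (2 L x)
  define f :: "real^'d \<Rightarrow> complex" where "f = indicator A"
  \<comment> \<open>This \<open>g\<close> is supported on the reflection of \<open>B\<close>, so the
    formula is taken from \<open>convolution_poisson_formula\<close> with that set and not from the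
    first claim, where \<open>g\<close> lives on \<open>B\<close>.\<close>
  define g :: "real^'d \<Rightarrow> complex" where "g = indicator (uminus ` B)"
  define m where "m n = measure lebesgue (A \<inter> (\<lambda>b. b + x + n) ` B)" for n
  have B: "bounded (uminus ` B)" "uminus ` B \<in> sets lebesgue"
    using assms(3,4) by (simp_all add: lebesgue_sets_reflect)
  have f: "f \<in> borel_measurable lebesgue" "bounded (range f)" "\<And>x. x \<notin> A \<Longrightarrow> f x = 0"
    and g: "g \<in> borel_measurable lebesgue" "bounded (range g)" "\<And>x. x \<notin> uminus ` B \<Longrightarrow> g x = 0"
    using assms(2) B(2)
    by (auto simp: f_def g_def bounded_iff indicator_def intro!: exI[of _ 1] borel_measurable_indicator)
  note P = convolution_poisson_formula[OF f(1,2) assms(1) f(3) g(1,2) B(1) g(3) 2]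
  have conv: "convolution f g (x + n) = complex_of_real (m n)" for n
    unfolding f_def g_def m_def convolution_indicator_reflect[OF assms(2,4)] by (simp add: add.assoc)
  \<comment> \<open>The indicator is real-valued, so the conjugation changes nothing; it brings
    \<open>g\<close> into the form whose transform is known.\<close>
  have "g = (\<lambda>x. cnj (indicator B (- x)))"
    by (force simp: g_def indicator_def image_iff)
  then have Fg: "fourier g \<xi> = cnj (fourier (indicator B) \<xi>)" for \<xi>
    using assms(4) by (simp add: fourier_cnj_reflect)
  note P' = P[of x, unfolded conv Fg, unfolded f_def]
  have sm: "m summable_on L" using summable_on_Re[OF P'(1)] by simp
  then have "(\<Sum>\<^sub>\<infinity>n\<in>L. complex_of_real (m n)) = complex_of_real (\<Sum>\<^sub>\<infinity>n\<in>L. m n)"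
    by (intro infsumI has_sum_of_real has_sum_infsum)
  then show ?case using sm P'(2,3) unfolding m_def by simp
qed

end
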